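(* Let $c\in\mathbb{R}\setminus\{0\}$ and consider the traveling wave profile equation (with $\alpha=1$) $$\phi'=\psi,\qquad \psi'=-c\psi-\phi^{-1},\qquad {}'=\frac{d}{d\xi},\qquad \phi>0 .$$ Quenching traveling wave solutions, that is, solutions $(\phi(\xi),\psi(\xi))$ with $\phi(\xi)\to 0$ and $\psi(\xi)\to-\infty$ as $\xi\to\xi_{\max}-0$ for some $\xi_{\max}<\infty$, are, if they exist, characterized by trajectories $(\lambda,x)$ (with $\lambda>0$, $x>0$) whose initial data are on the center-stable manifold $W^{cs}(p_0)$ of the equilibrium $p_0=(\lambda,x)=(0,0)$ for the desingularized vector field $$\frac{d\lambda}{d\tau}=cx\lambda-\lambda^3,\qquad \frac{dx}{d\tau}=-x+x(cx-\lambda^2).$$ The quenching rates, namely the extinction rate of $\phi$ and the blow-up rate of $\psi$, are $$\phi(\xi)\sim C(\xi_{\max}-\xi)\left(\ln(\xi_{\max}-\xi)^{-1}\right)^{1/2},\qquad \psi(\xi)\sim -C\left(\ln(\xi_{\max}-\xi)^{-1}\right)^{1/2}\qquad\text{as }\xi\to\xi_{\max}$$ with $C>0$.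
   Context: A traveling wave is a function $u(t,x)=\phi(x-ct)=\phi(\xi)$, and the profile equation above is $-c\phi'=\phi''+\phi^{-\alpha}$ with $\alpha=1$, written as a first-order system. The two systems are related by the change of variables $\phi=x/\lambda$, $\psi=-1/\lambda$ and the change of independent variable $\frac{d\xi}{d\tau}=\phi\lambda=x$ (positive for $x>0$), where the $x$ in $(\lambda,x)$ is a compactified phase variable, not the spatial coordinate. The set $\{\lambda=0\}$ corresponds to infinity. The linearization of the desingularized field at $p_0$ has eigenvalues $0$ and $-1$, and $W^{cs}(p_0)$ is the (local) center-stable manifold. $f\sim g$ as $\xi\to\xi_{\max}$ means $f(\xi)/g(\xi)\to 1$ as $\xi\to\xi_{\max}-0$. $C$ is a generic positive constant that may differ between the two relations. *)

theory Defs
  imports "HOL-Analysis.Analysis" "HOL-Library.Landau_Symbols"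
begin

section \<open>Autonomous systems and local center-stable manifolds\<close>

definition solves_on :: "('a::real_normed_vector \<Rightarrow> 'a) \<Rightarrow> (real \<Rightarrow> 'a) \<Rightarrow> real set \<Rightarrow> bool" where
  "solves_on F \<gamma> J \<longleftrightarrow> (\<forall>t\<in>J. (\<gamma> has_vector_derivative F (\<gamma> t)) (at t within J))"

text \<open>A forward trajectory is a solution with initial time 0 on an interval that cannot be
  extended further to the right.\<close>

definition forward_trajectory :: "('a::real_normed_vector \<Rightarrow> 'a) \<Rightarrow> (real \<Rightarrow> 'a) \<Rightarrow> real set \<Rightarrow> bool" where
  "forward_trajectory F \<gamma> J \<longleftrightarrow>
     is_interval J \<and> 0 \<in> J \<and> J \<subseteq> {0..} \<and> solves_on F \<gamma> J \<and>
     (\<forall>J' \<gamma>'. is_interval J' \<and> J \<subseteq> J' \<and> J' \<subseteq> {0..} \<and> solves_on F \<gamma>' J' \<and> (\<forall>t\<in>J. \<gamma>' t = \<gamma> t)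
        \<longrightarrow> J' = J)"

text \<open>For a linear map \<open>A\<close> this is the kernel of \<open>((A - a)^2 + b^2)^n\<close> with \<open>n\<close> the dimension: the
  real generalized eigenspace belonging to the eigenvalues \<open>a + i b\<close> and \<open>a - i b\<close>
  (for \<open>b = 0\<close>: to the real eigenvalue \<open>a\<close>). It is the zero space if these are not eigenvalues.\<close>

definition real_gen_eigenspace :: "('a::euclidean_space \<Rightarrow> 'a) \<Rightarrow> real \<Rightarrow> real \<Rightarrow> 'a set" where
  "real_gen_eigenspace A a b =
     {v. ((\<lambda>w. A (A w) - (2 * a) *\<^sub>R A w + (a\<^sup>2 + b\<^sup>2) *\<^sub>R w) ^^ DIM('a)) v = 0}"

definition center_stable_subspace :: "('a::euclidean_space \<Rightarrow> 'a) \<Rightarrow> 'a set" where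
  "center_stable_subspace A = span (\<Union>a\<in>{..0}. \<Union>b. real_gen_eigenspace A a b)"

definition unstable_subspace :: "('a::euclidean_space \<Rightarrow> 'a) \<Rightarrow> 'a set" where
  "unstable_subspace A = span (\<Union>a\<in>{0<..}. \<Union>b. real_gen_eigenspace A a b)"

text \<open>A local center-stable manifold of the equilibrium \<open>p\<close> is a locally invariant \<open>C\<^sup>1\<close> graph over a
  neighbourhood of 0 in the center-stable subspace of the linearization, with values in the unstable
  subspace, through \<open>p\<close> and tangent there to the center-stable subspace. As usual, such a manifold
  need not be unique. Only the restriction of \<open>h' v\<close> to the center-stable subspace is meaningful.\<close>

definition local_center_stable_manifold :: "('a::euclidean_space \<Rightarrow> 'a) \<Rightarrow> 'a \<Rightarrow> 'a set \<Rightarrow> bool" where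
  "local_center_stable_manifold F p W \<longleftrightarrow>
     F p = 0 \<and>
     (\<exists>A. (F has_derivative A) (at p) \<and>
       (\<exists>V h h'. let E = center_stable_subspace A in
          open V \<and> 0 \<in> V \<and>
          (\<forall>v \<in> E \<inter> V. h v \<in> unstable_subspace A) \<and>
          (\<forall>v \<in> E \<inter> V. (h has_derivative h' v) (at v within E \<inter> V)) \<and>
          (\<forall>w \<in> E. continuous_on (E \<inter> V) (\<lambda>v. h' v w)) \<and>
          h 0 = 0 \<and> (\<forall>w \<in> E. h' 0 w = 0) \<and>
          W = (\<lambda>v. p + v + h v) ` (E \<inter> V))) \<and>
     (\<exists>U. open U \<and> W \<subseteq> U \<and>
       (\<forall>\<gamma> J. is_interval J \<and> 0 \<in> J \<and> solves_on F \<gamma> J \<and> \<gamma> 0 \<in> W \<and> \<gamma> ` J \<subseteq> U \<longrightarrow> \<gamma> ` J \<subseteq> W))"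

section \<open>The traveling wave profile equation and its desingularization\<close>

definition profile_solution :: "real \<Rightarrow> real set \<Rightarrow> (real \<Rightarrow> real) \<Rightarrow> (real \<Rightarrow> real) \<Rightarrow> bool" where
  "profile_solution c I \<phi> \<psi> \<longleftrightarrow>
     (\<forall>\<xi>\<in>I. \<phi> \<xi> > 0 \<and>
        (\<phi> has_real_derivative \<psi> \<xi>) (at \<xi> within I) \<and>
        (\<psi> has_real_derivative (- c * \<psi> \<xi> - inverse (\<phi> \<xi>))) (at \<xi> within I))"

definition quenching_solution :: "real \<Rightarrow> real \<Rightarrow> real \<Rightarrow> (real \<Rightarrow> real) \<Rightarrow> (real \<Rightarrow> real) \<Rightarrow> bool" where
  "quenching_solution c \<xi>\<^sub>0 \<xi>\<^sub>m\<^sub>a\<^sub>x \<phi> \<psi> \<longleftrightarrow>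
     \<xi>\<^sub>0 < \<xi>\<^sub>m\<^sub>a\<^sub>x \<and> profile_solution c {\<xi>\<^sub>0..<\<xi>\<^sub>m\<^sub>a\<^sub>x} \<phi> \<psi> \<and>
     (\<phi> \<longlongrightarrow> 0) (at_left \<xi>\<^sub>m\<^sub>a\<^sub>x) \<and> filterlim \<psi> at_bot (at_left \<xi>\<^sub>m\<^sub>a\<^sub>x)"

text \<open>Phase points are pairs \<open>(\<lambda>, x)\<close>; \<open>l\<close> stands for \<open>\<lambda>\<close>.\<close>

definition desing_field :: "real \<Rightarrow> real \<times> real \<Rightarrow> real \<times> real" where
  "desing_field c = (\<lambda>(l, x). (c * x * l - l ^ 3, - x + x * (c * x - l\<^sup>2)))"

definition positive_trajectory_from ::
    "real \<Rightarrow> (real \<times> real) set \<Rightarrow> (real \<Rightarrow> real \<times> real) \<Rightarrow> real set \<Rightarrow> bool" where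
  "positive_trajectory_from c W \<gamma> J \<longleftrightarrow>
     forward_trajectory (desing_field c) \<gamma> J \<and> \<gamma> 0 \<in> W \<and>
     (\<forall>\<tau>\<in>J. fst (\<gamma> \<tau>) > 0 \<and> snd (\<gamma> \<tau>) > 0)"

text \<open>The change of variables \<open>\<phi> = x / \<lambda>\<close>, \<open>\<psi> = -1 / \<lambda>\<close>, with \<open>\<xi> = s \<tau>\<close> and \<open>d\<xi>/d\<tau> = x\<close>.\<close>

definition corresponds ::
    "(real \<Rightarrow> real) \<Rightarrow> (real \<Rightarrow> real) \<Rightarrow> real \<Rightarrow> real \<Rightarrow> (real \<Rightarrow> real \<times> real) \<Rightarrow> real set \<Rightarrow> bool" where
  "corresponds \<phi> \<psi> \<xi>\<^sub>0 \<xi>\<^sub>m\<^sub>a\<^sub>x \<gamma> J \<longleftrightarrow>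
     (\<exists>s. bij_betw s J {\<xi>\<^sub>0..<\<xi>\<^sub>m\<^sub>a\<^sub>x} \<and> s 0 = \<xi>\<^sub>0 \<and>
        (\<forall>\<tau>\<in>J. (s has_real_derivative snd (\<gamma> \<tau>)) (at \<tau> within J) \<and>
           \<phi> (s \<tau>) = snd (\<gamma> \<tau>) / fst (\<gamma> \<tau>) \<and> \<psi> (s \<tau>) = - 1 / fst (\<gamma> \<tau>)))"

end

theory Submission
  imports Defs
begin

text \<open>
  At the origin the linearization has eigenvalues \<open>0\<close> and \<open>- 1\<close>, so there is no unstable direction and
  every local center-stable manifold is simply an open neighbourhood of the origin
  (\<open>center_stable_manifold_iff_open_neighbourhood\<close>). The characterization thus says: every quenching
  solution enters each neighbourhood of the origin, and every positive trajectory that starts close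
  enough to it quenches. The first half is clear, because \<open>\<lambda> = - 1 / \<psi>\<close> and \<open>x = - \<phi> / \<psi>\<close> tend to \<open>0\<close>
  (\<open>trajectory_of_quenching_solution\<close>).

  Two exact formulas carry the rest. In the time \<open>\<tau>\<close> with \<open>d\<xi>/d\<tau> = x\<close> the profile satisfies
  \<open>d\<phi>/d\<tau> = - \<phi>\<close>, hence \<open>\<tau> = - ln \<phi> + const\<close>. And the profile equation has the first integral
  \<open>(\<psi> + c \<phi>)\<^sup>2 / 2 + c \<xi> + ln \<phi>\<close> (\<open>profile_first_integral\<close>).

  For the second half take the strip \<open>\<bar>c x\<bar> < 1 / 2\<close> as the neighbourhood. It is forward invariant for
  positive trajectories, and in it \<open>x\<close> decays exponentially while \<open>\<lambda>\<close> grows at most exponentially. Such a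
  trajectory exists for all times (\<open>positive_trajectory_in_strip_is_global\<close>), and \<open>\<xi>\<close>, the integral of
  \<open>x\<close>, has a finite limit. By the two formulas \<open>\<phi> \<rightarrow> 0\<close> and \<open>(\<psi> + c \<phi>)\<^sup>2 \<rightarrow> \<infinity>\<close>, so the solution quenches
  (\<open>quenching_solution_of_trajectory\<close>). Global existence rests on local existence at the endpoint of a
  closed time interval; a quadrature provides it (\<open>desing_field_local_solution\<close>).

  The rates, with \<open>C = sqrt 2\<close> in both, come from the first integral: it gives \<open>\<psi>\<^sup>2 \<sim> - 2 ln \<phi>\<close>, and
  \<open>x \<sim> \<xi>\<^sub>m\<^sub>a\<^sub>x - \<xi>\<close> lets one replace \<open>ln \<phi>\<close> by \<open>ln (\<xi>\<^sub>m\<^sub>a\<^sub>x - \<xi>)\<close> (\<open>quenching_rates_limits\<close>).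
\<close>

section \<open>Center-stable manifolds of the origin\<close>

lemma desing_field_linearization:
  "(desing_field c has_derivative (\<lambda>v. (0, - snd v))) (at (0, 0))"
proof -
  have "((\<lambda>p. (c * snd p * fst p - fst p ^ 3, - snd p + snd p * (c * snd p - (fst p)\<^sup>2)))
      has_derivative (\<lambda>v. (0, - snd v))) (at (0 :: real, 0 :: real))"
    by (auto intro!: derivative_eq_intros)
  then show ?thesis
    by (simp add: desing_field_def case_prod_unfold)
qed

lemma center_stable_subspace_linearization:
  "center_stable_subspace (\<lambda>v :: real \<times> real. (0, - snd v)) = UNIV"
proof -
  let ?A = "\<lambda>v :: real \<times> real. (0, - snd v)"
  let ?G = "\<Union>a\<in>{..0}. \<Union>b. real_gen_eigenspace ?A a b"
  have "(1, 0) \<in> real_gen_eigenspace ?A 0 0"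
    by (simp add: real_gen_eigenspace_def numeral_2_eq_2 zero_prod_def)
  then have e1: "(1, 0) \<in> span ?G"
    by (intro span_base) blast
  have "(0, 1) \<in> real_gen_eigenspace ?A (-1) 0"
    by (simp add: real_gen_eigenspace_def numeral_2_eq_2 zero_prod_def)
  then have e2: "(0, 1) \<in> span ?G"
    by (intro span_base) fastforce
  have "v \<in> span ?G" for v
  proof -
    have "fst v *\<^sub>R (1, 0) + snd v *\<^sub>R (0, 1) \<in> span ?G"
      by (intro span_add span_mul e1 e2)
    then show ?thesis
      by simp
  qed
  then show ?thesis
    by (auto simp: center_stable_subspace_def)
qed

lemma unstable_subspace_linearization:
  "unstable_subspace (\<lambda>v :: real \<times> real. (0, - snd v)) = {0}"
proof -
  let ?A = "\<lambda>v :: real \<times> real. (0, - snd v)"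
  have "v = 0" if "a > 0" "v \<in> real_gen_eigenspace ?A a b" for a b v
  proof -
    have pos: "a\<^sup>2 + b\<^sup>2 > 0"
      using that(1) by (simp add: add_pos_nonneg)
    define k where "k = a\<^sup>2 + b\<^sup>2"
    have k: "k > 0" "1 + 2 * a + k > 0"
      using pos that(1) by (auto simp: k_def)
    have "(\<lambda>w. ?A (?A w) - (2 * a) *\<^sub>R ?A w + (a\<^sup>2 + b\<^sup>2) *\<^sub>R w)
        = (\<lambda>w. (k * fst w, (1 + 2 * a + k) * snd w))"
      by (auto simp: k_def prod_eq_iff algebra_simps)
    then have "((\<lambda>w. (k * fst w, (1 + 2 * a + k) * snd w)) ^^ DIM(real \<times> real)) v = 0"
      using that(2) unfolding real_gen_eigenspace_def mem_Collect_eq by metis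
    then have "k * (k * fst v) = 0" "(1 + 2 * a + k) * ((1 + 2 * a + k) * snd v) = 0"
      by (simp_all add: numeral_2_eq_2 zero_prod_def)
    with k show ?thesis
      by (auto simp: zero_prod_def prod_eq_iff)
  qed
  then have "(\<Union>a\<in>{0<..}. \<Union>b. real_gen_eigenspace ?A a b) \<subseteq> {0}"
    by auto
  then have "unstable_subspace ?A \<subseteq> span {0}"
    unfolding unstable_subspace_def by (rule span_mono)
  moreover have "0 \<in> unstable_subspace ?A"
    unfolding unstable_subspace_def by (rule span_zero)
  ultimately show ?thesis
    by (simp add: subset_singleton_iff) blast
qed

text \<open>Both eigenvalues at the origin, \<open>0\<close> and \<open>- 1\<close>, have nonpositive real part, so the center-stable
  subspace is the whole plane, the unstable subspace is trivial, and the graph map \<open>h\<close> vanishes. Local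
  invariance holds because the open set \<open>W\<close> can itself be taken as the neighbourhood \<open>U\<close>.\<close>

lemma center_stable_manifold_iff_open_neighbourhood:
  "local_center_stable_manifold (desing_field c) (0, 0) W \<longleftrightarrow> open W \<and> (0, 0) \<in> W"
proof
  assume L: "local_center_stable_manifold (desing_field c) (0, 0) W"
  then obtain A V h where A: "(desing_field c has_derivative A) (at (0, 0))"
    and V: "open V" "0 \<in> V"
    and h: "\<forall>v \<in> center_stable_subspace A \<inter> V. h v \<in> unstable_subspace A"
    and W: "W = (\<lambda>v. (0, 0) + v + h v) ` (center_stable_subspace A \<inter> V)"
    unfolding local_center_stable_manifold_def Let_def by blast
  have "A = (\<lambda>v. (0, - snd v))"
    using has_derivative_unique[OF A desing_field_linearization] .
  then have "\<forall>v \<in> V. h v = 0" "W = (\<lambda>v. (0, 0) + v + h v) ` V"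
    using h W by (simp_all add: center_stable_subspace_linearization unstable_subspace_linearization)
  then have "W = V"
    by (simp add: zero_prod_def[symmetric])
  then show "open W \<and> (0, 0) \<in> W"
    using V by (simp add: zero_prod_def)
next
  assume W: "open W \<and> (0, 0) \<in> W"
  show "local_center_stable_manifold (desing_field c) (0, 0) W"
    unfolding local_center_stable_manifold_def
  proof (intro conjI exI)
    show "desing_field c (0, 0) = 0"
      by (simp add: desing_field_def zero_prod_def)
    show "(desing_field c has_derivative (\<lambda>v. (0, - snd v))) (at (0, 0))"
      by (rule desing_field_linearization)
    show "let E = center_stable_subspace (\<lambda>v. (0, - snd v)) in
          open W \<and> 0 \<in> W \<and>
          (\<forall>v \<in> E \<inter> W. (0 :: real \<times> real) \<in> unstable_subspace (\<lambda>v. (0, - snd v))) \<and>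
          (\<forall>v \<in> E \<inter> W. ((\<lambda>v. 0 :: real \<times> real) has_derivative (\<lambda>v. 0)) (at v within E \<inter> W)) \<and>
          (\<forall>w \<in> E. continuous_on (E \<inter> W) (\<lambda>v. 0 :: real \<times> real)) \<and>
          (0 :: real \<times> real) = 0 \<and> (\<forall>w \<in> E. (0 :: real \<times> real) = 0) \<and>
          W = (\<lambda>v. (0, 0) + v + 0) ` (E \<inter> W)"
      using W
      by (simp add: center_stable_subspace_linearization unstable_subspace_linearization zero_prod_def[symmetric])
    show "\<forall>\<gamma> J. is_interval J \<and> 0 \<in> J \<and> solves_on (desing_field c) \<gamma> J \<and> \<gamma> 0 \<in> W \<and> \<gamma> ` J \<subseteq> W
        \<longrightarrow> \<gamma> ` J \<subseteq> W"
      by blast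
  qed (use W in auto)
qed

section \<open>Monotone functions on intervals\<close>

lemma mean_value_on_interval:
  fixes f :: "real \<Rightarrow> real"
  assumes I: "is_interval I"
    and f: "\<And>t. t \<in> I \<Longrightarrow> (f has_real_derivative f' t) (at t within I)"
    and rs: "r \<in> I" "s \<in> I" "r < s"
  obtains t where "t \<in> I" "f s - f r = f' t * (s - r)"
proof -
  have sub: "{r..s} \<subseteq> I"
    using mem_is_interval_1_I[OF I rs(1,2)] by auto
  have "\<exists>t\<in>{r<..<s}. f s - f r = f' t * (s - r)"
  proof (rule mvt_simple[OF rs(3)])
    fix t assume "r \<le> t" "t \<le> s"
    then have "t \<in> I" using sub by auto
    from f[OF this] show "(f has_derivative (*) (f' t)) (at t within {r..s})"
      unfolding has_field_derivative_def by (rule has_derivative_subset[OF _ sub])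
  qed
  then obtain t where "t \<in> {r<..<s}" "f s - f r = f' t * (s - r)" ..
  with sub show thesis by (intro that[of t]) auto
qed

lemma strict_mono_on_interval_if_deriv_pos:
  fixes f :: "real \<Rightarrow> real"
  assumes "is_interval I"
    and "\<And>t. t \<in> I \<Longrightarrow> (f has_real_derivative f' t) (at t within I)"
    and pos: "\<And>t. t \<in> I \<Longrightarrow> f' t > 0"
  shows "strict_mono_on I f"
proof (rule strict_mono_onI)
  fix r s assume rs: "r \<in> I" "s \<in> I" "r < s"
  obtain t where "t \<in> I" "f s - f r = f' t * (s - r)"
    using mean_value_on_interval[OF assms(1,2) rs] .
  then show "f r < f s"
    using rs pos[of t] mult_pos_pos[of "f' t" "s - r"] by linarith
qed

lemma antimono_on_interval_if_deriv_nonpos: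
  fixes f :: "real \<Rightarrow> real"
  assumes "is_interval I"
    and "\<And>t. t \<in> I \<Longrightarrow> (f has_real_derivative f' t) (at t within I)"
    and neg: "\<And>t. t \<in> I \<Longrightarrow> f' t \<le> 0"
  shows "antimono_on I f"
proof (rule monotone_onI)
  fix r s assume rs: "r \<in> I" "s \<in> I" "r \<le> s"
  show "f s \<le> f r"
  proof (cases "r = s")
    case False
    then have less: "r < s" using rs by simp
    obtain t where "t \<in> I" "f s - f r = f' t * (s - r)"
      using mean_value_on_interval[OF assms(1,2) rs(1,2) less] .
    then show ?thesis
      using rs neg[of t] mult_nonpos_nonneg[of "f' t" "s - r"] by linarith
  qed simp
qed

text \<open>The changes of independent variable below live on half-open intervals, so derivatives are taken
  within \<open>I\<close> and its image, endpoints included. The difference quotient of the inverse is the reciprocal of that of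
  \<open>f\<close>, once the inverse is known to be continuous at \<open>f t\<close>.\<close>

lemma increasing_inverse_has_derivative:
  fixes f :: "real \<Rightarrow> real"
  assumes I: "is_interval I"
    and f: "\<And>t. t \<in> I \<Longrightarrow> (f has_real_derivative f' t) (at t within I)"
    and pos: "\<And>t. t \<in> I \<Longrightarrow> f' t > 0"
    and t: "t \<in> I"
  shows "(the_inv_into I f has_real_derivative 1 / f' t) (at (f t) within f ` I)"
proof -
  let ?g = "the_inv_into I f"
  have sm: "strict_mono_on I f"
    by (rule strict_mono_on_interval_if_deriv_pos[OF I, of f f']) (simp_all add: f pos)
  then have inj: "inj_on f I"
    using strict_mono_on_imp_inj_on by blast
  have less: "f r < f s \<longleftrightarrow> r < s" if "r \<in> I" "s \<in> I" for r s
    using strict_mono_on_less[OF sm that] .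
  have g: "?g (f r) = r" if "r \<in> I" for r
    using the_inv_into_f_f[OF inj that] .
  have lim: "(?g \<longlongrightarrow> t) (at (f t) within f ` I)"
  proof (rule order_tendstoI)
    fix a assume "a < t"
    show "\<forall>\<^sub>F y in at (f t) within f ` I. a < ?g y"
    proof (cases "a \<in> I")
      case True
      then have "f a < f t" using less t \<open>a < t\<close> by blast
      then have "\<forall>\<^sub>F y in at (f t) within f ` I. f a < y"
        by (intro order_tendstoD[OF tendsto_ident_at])
      moreover have "\<forall>\<^sub>F y in at (f t) within f ` I. y \<in> f ` I"
        by (simp add: eventually_at_filter)
      ultimately show ?thesis
        by eventually_elim (auto simp: less g True)
    next
      case False
      then have "a < r" if "r \<in> I" for r
        using mem_is_interval_1_I[OF I that t, of a] \<open>a < t\<close> by fastforce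
      moreover have "\<forall>\<^sub>F y in at (f t) within f ` I. y \<in> f ` I"
        by (simp add: eventually_at_filter)
      ultimately show ?thesis
        by (auto elim!: eventually_mono simp: g)
    qed
  next
    fix a assume "t < a"
    show "\<forall>\<^sub>F y in at (f t) within f ` I. ?g y < a"
    proof (cases "a \<in> I")
      case True
      then have "f t < f a" using less t \<open>t < a\<close> by blast
      then have "\<forall>\<^sub>F y in at (f t) within f ` I. y < f a"
        by (intro order_tendstoD[OF tendsto_ident_at])
      moreover have "\<forall>\<^sub>F y in at (f t) within f ` I. y \<in> f ` I"
        by (simp add: eventually_at_filter)
      ultimately show ?thesis
        by eventually_elim (auto simp: less g True)
    next
      case False
      then have "r < a" if "r \<in> I" for r
        using mem_is_interval_1_I[OF I t that, of a] \<open>t < a\<close> by fastforce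
      moreover have "\<forall>\<^sub>F y in at (f t) within f ` I. y \<in> f ` I"
        by (simp add: eventually_at_filter)
      ultimately show ?thesis
        by (auto elim!: eventually_mono simp: g)
    qed
  qed
  have filt: "filterlim ?g (at t within I) (at (f t) within f ` I)"
    unfolding filterlim_at using lim by (auto simp: eventually_at_filter g t intro!: always_eventually)
  have "((\<lambda>s. (f s - f t) / (s - t)) \<longlongrightarrow> f' t) (at t within I)"
    using f[OF t] by (simp add: has_field_derivative_iff)
  from filterlim_compose[OF this filt]
  have "((\<lambda>y. (f (?g y) - f t) / (?g y - t)) \<longlongrightarrow> f' t) (at (f t) within f ` I)" .
  from tendsto_inverse[OF this]
  have "((\<lambda>y. inverse ((f (?g y) - f t) / (?g y - t))) \<longlongrightarrow> 1 / f' t) (at (f t) within f ` I)"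
    using pos[OF t] by (simp add: inverse_eq_divide)
  moreover have "\<forall>\<^sub>F y in at (f t) within f ` I.
      inverse ((f (?g y) - f t) / (?g y - t)) = (?g y - ?g (f t)) / (y - f t)"
    by (auto simp: eventually_at_filter g t intro!: always_eventually)
  ultimately show ?thesis
    unfolding has_field_derivative_iff by (rule Lim_transform_eventually)
qed

lemma decreasing_bounded_below_tendsto_at_left:
  fixes f :: "real \<Rightarrow> real"
  assumes "a < b" and anti: "antimono_on {a..<b} f" and bd: "\<And>t. t \<in> {a..<b} \<Longrightarrow> B \<le> f t"
  shows "\<exists>l. (f \<longlongrightarrow> l) (at_left b)"
proof -
  let ?l = "Inf (f ` {a..<b})"
  have bdd: "bdd_below (f ` {a..<b})"
    using bd by (auto intro!: bdd_belowI[of _ B])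
  have "(f \<longlongrightarrow> ?l) (at_left b)"
  proof (rule order_tendstoI)
    fix y assume "y < ?l"
    have "\<forall>\<^sub>F t in at_left b. t \<in> {a<..<b}"
      using eventually_at_left_real[OF assms(1)] .
    then show "\<forall>\<^sub>F t in at_left b. y < f t"
    proof eventually_elim
      case (elim t)
      then have "?l \<le> f t" by (intro cInf_lower[OF _ bdd]) auto
      then show ?case using \<open>y < ?l\<close> by simp
    qed
  next
    fix y assume "?l < y"
    then obtain s where s: "s \<in> {a..<b}" "f s < y"
      using cInf_less_iff[of "f ` {a..<b}"] bdd assms(1) by auto
    have "\<forall>\<^sub>F t in at_left b. t \<in> {s<..<b}"
      using s by (intro eventually_at_left_real) auto
    then show "\<forall>\<^sub>F t in at_left b. f t < y"
    proof eventually_elim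
      case (elim t)
      then have "f t \<le> f s" using s by (intro monotone_onD[OF anti]) auto
      then show ?case using s by simp
    qed
  qed
  then show ?thesis ..
qed

section \<open>Extending solutions of autonomous systems\<close>

text \<open>The equation at the endpoints and at the points of \<open>S\<close> comes for free: integrating it recovers
  \<open>\<gamma>\<close> as an antiderivative of the continuous function \<open>F \<circ> \<gamma>\<close>. This is what makes it possible to glue
  solutions and to add limit points.\<close>

lemma solves_on_if_continuous_and_derivative_off_finite:
  fixes F :: "'a::banach \<Rightarrow> 'a"
  assumes ab: "a \<le> b" and S: "finite S" and F: "continuous_on UNIV F"
    and cont: "continuous_on {a..b} \<gamma>"
    and der: "\<And>t. t \<in> {a<..<b} - S \<Longrightarrow> (\<gamma> has_vector_derivative F (\<gamma> t)) (at t)"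
  shows "solves_on F \<gamma> {a..b}"
  unfolding solves_on_def
proof
  fix t assume t: "t \<in> {a..b}"
  have contF: "continuous_on {a..b} (\<lambda>t. F (\<gamma> t))"
    using continuous_on_compose2[OF F cont] by simp
  have I: "\<gamma> u = \<gamma> a + integral {a..u} (\<lambda>t. F (\<gamma> t))" if "u \<in> {a..b}" for u
  proof -
    have "((\<lambda>t. F (\<gamma> t)) has_integral (\<gamma> u - \<gamma> a)) {a..u}"
      using that by (intro fundamental_theorem_of_calculus_interior_strong[OF S] der)
        (auto intro: continuous_on_subset[OF cont])
    then show ?thesis by (simp add: integral_unique)
  qed
  have "((\<lambda>u. \<gamma> a + integral {a..u} (\<lambda>t. F (\<gamma> t))) has_vector_derivative F (\<gamma> t)) (at t within {a..b})"
    using integral_has_vector_derivative[OF contF t]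
    by (auto intro!: derivative_eq_intros)
  then show "(\<gamma> has_vector_derivative F (\<gamma> t)) (at t within {a..b})"
    by (rule has_vector_derivative_transform[OF t, rotated]) (rule I)
qed

lemma solves_on_imp_continuous_on: "solves_on F \<gamma> J \<Longrightarrow> continuous_on J \<gamma>"
  unfolding solves_on_def continuous_on_eq_continuous_within
  using has_vector_derivative_continuous by blast

lemma solves_on_interior:
  assumes "solves_on F \<gamma> J" "t \<in> interior J"
  shows "(\<gamma> has_vector_derivative F (\<gamma> t)) (at t)"
proof -
  have "t \<in> J" using assms(2) interior_subset by blast
  then have "(\<gamma> has_vector_derivative F (\<gamma> t)) (at t within J)"
    using assms(1) by (simp add: solves_on_def)
  then show ?thesis
    by (simp add: at_within_interior[OF assms(2)])
qed

lemma solves_on_concatenate: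
  fixes F :: "'a::banach \<Rightarrow> 'a"
  assumes F: "continuous_on UNIV F" and T: "0 \<le> T" and \<epsilon>: "0 \<le> \<epsilon>"
    and \<gamma>: "solves_on F \<gamma> {0..T}" and \<delta>: "solves_on F \<delta> {0..\<epsilon>}" and eq: "\<delta> 0 = \<gamma> T"
  shows "solves_on F (\<lambda>t. if t \<le> T then \<gamma> t else \<delta> (t - T)) {0..T + \<epsilon>}"
proof (rule solves_on_if_continuous_and_derivative_off_finite[where S = "{T}"])
  let ?\<eta> = "\<lambda>t. if t \<le> T then \<gamma> t else \<delta> (t - T)"
  show "continuous_on {0..T + \<epsilon>} ?\<eta>"
  proof -
    have "continuous_on ({0..T} \<union> {T..T + \<epsilon>}) ?\<eta>"
    proof (rule continuous_on_cases)
      show "continuous_on {0..T} \<gamma>"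
        using \<gamma> by (rule solves_on_imp_continuous_on)
      show "continuous_on {T..T + \<epsilon>} (\<lambda>t. \<delta> (t - T))"
        by (rule continuous_on_compose2[OF solves_on_imp_continuous_on[OF \<delta>]])
          (auto intro!: continuous_intros)
    qed (use eq in auto)
    moreover have "{0..T} \<union> {T..T + \<epsilon>} = {0..T + \<epsilon>}"
      using T \<epsilon> by auto
    ultimately show ?thesis by simp
  qed
  show "(?\<eta> has_vector_derivative F (?\<eta> t)) (at t)" if t: "t \<in> {0<..<T + \<epsilon>} - {T}" for t
  proof (cases "t < T")
    case True
    have "(\<gamma> has_vector_derivative F (\<gamma> t)) (at t)"
      using solves_on_interior[OF \<gamma>] True t by simp
    then have "(?\<eta> has_vector_derivative F (\<gamma> t)) (at t)"
      by (rule has_vector_derivative_transform_within_open[of _ _ _ "{..<T}"]) (use True in auto)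
    then show ?thesis using True by simp
  next
    case False
    then have "t > T" using t by auto
    have "(\<delta> has_vector_derivative F (\<delta> (t - T))) (at (t - T))"
      using solves_on_interior[OF \<delta>] \<open>t > T\<close> t by simp
    then have "((\<lambda>t. \<delta> (t - T)) has_vector_derivative F (\<delta> (t - T))) (at t)"
      using vector_diff_chain_at[of "\<lambda>t. t - T" 1 t \<delta>]
      by (simp add: o_def has_vector_derivative_diff_const)
    then have "(?\<eta> has_vector_derivative F (\<delta> (t - T))) (at t)"
      by (rule has_vector_derivative_transform_within_open[of _ _ _ "{T<..}"]) (use \<open>t > T\<close> in auto)
    then show ?thesis using \<open>t > T\<close> by simp
  qed
qed (use F T \<epsilon> in auto)

lemma solves_on_extend_to_limit:
  fixes F :: "'a::banach \<Rightarrow> 'a"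
  assumes F: "continuous_on UNIV F" and T: "0 < T"
    and \<gamma>: "solves_on F \<gamma> {0..<T}" and lim: "(\<gamma> \<longlongrightarrow> p) (at_left T)"
  shows "solves_on F (\<gamma>(T := p)) {0..T}"
proof (rule solves_on_if_continuous_and_derivative_off_finite[where S = "{}"])
  have der: "(\<gamma>(T := p) has_vector_derivative F ((\<gamma>(T := p)) t)) (at t)" if "t \<in> {0<..<T}" for t
  proof -
    have "(\<gamma> has_vector_derivative F (\<gamma> t)) (at t)"
      using solves_on_interior[OF \<gamma>] that by simp
    then have "(\<gamma>(T := p) has_vector_derivative F (\<gamma> t)) (at t)"
      by (rule has_vector_derivative_transform_within_open[of _ _ _ "{..<T}"]) (use that in auto)
    then show ?thesis using that by simp
  qed
  then show "(\<gamma>(T := p) has_vector_derivative F ((\<gamma>(T := p)) t)) (at t)" if "t \<in> {0<..<T} - {}" for t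
    using that by blast
  show "continuous_on {0..T} (\<gamma>(T := p))"
  proof (rule continuous_on_IccI)
    have "continuous_on {0..T / 2} \<gamma>"
      by (rule continuous_on_subset[OF solves_on_imp_continuous_on[OF \<gamma>]]) (use T in auto)
    then have "(\<gamma> \<longlongrightarrow> \<gamma> 0) (at 0 within {0..T / 2})"
      using T by (simp add: continuous_on_def)
    then have "(\<gamma> \<longlongrightarrow> \<gamma> 0) (at_right 0)"
      using T at_within_Icc_at_right[of 0 "T / 2"] by simp
    moreover have "\<forall>\<^sub>F t in at_right 0. \<gamma> t = (\<gamma>(T := p)) t"
      using eventually_at_right_real[OF T] by eventually_elim auto
    ultimately show "(\<gamma>(T := p) \<longlongrightarrow> (\<gamma>(T := p)) 0) (at_right 0)"
      using T by (auto intro: Lim_transform_eventually)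
    have "\<forall>\<^sub>F t in at_left T. \<gamma> t = (\<gamma>(T := p)) t"
      using eventually_at_left_real[OF T] by eventually_elim auto
    with lim show "(\<gamma>(T := p) \<longlongrightarrow> (\<gamma>(T := p)) T) (at_left T)"
      by (auto intro: Lim_transform_eventually)
    show "\<gamma>(T := p) \<midarrow>t\<rightarrow> (\<gamma>(T := p)) t" if "0 < t" "t < T" for t
      using has_vector_derivative_continuous[OF der[of t]] that unfolding continuous_at by auto
  qed (rule T)
qed (use F T in auto)

lemma forward_interval_cases:
  fixes J :: "real set"
  assumes J: "is_interval J" "0 \<in> J" "J \<subseteq> {0..}"
  obtains "J = {0..}" | T where "0 \<le> T" "J = {0..T}" | T where "0 < T" "J = {0..<T}"
proof (cases "bdd_above J")
  case False
  have "t \<in> J" if "0 \<le> t" for t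
  proof -
    obtain s where "s \<in> J" "t \<le> s"
      using False unfolding bdd_above_def by (meson less_imp_le not_less)
    then show ?thesis using mem_is_interval_1_I[OF J(1,2)] that by blast
  qed
  then have "J = {0..}" using J(3) by auto
  then show thesis by (rule that(1))
next
  case True
  define T where "T = Sup J"
  have le: "t \<le> T" if "t \<in> J" for t
    using cSup_upper[OF that True] by (simp add: T_def)
  have less: "t \<in> J" if t: "0 \<le> t" "t < T" for t
  proof -
    obtain s where "s \<in> J" "t < s"
      using t(2) less_cSup_iff[of J t] True J(2) unfolding T_def by blast
    then show ?thesis using mem_is_interval_1_I[OF J(1,2)] t(1) by (meson less_imp_le)
  qed
  show thesis
  proof (cases "T \<in> J")
    case True
    have "t \<in> J \<longleftrightarrow> 0 \<le> t \<and> t \<le> T" for t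
      using le[of t] less[of t] True J(3) by (cases "t = T") auto
    then have "J = {0..T}"
      by (intro set_eqI) simp
    with le[OF J(2)] show thesis by (rule that(2))
  next
    case False
    then have "0 < T" using le[OF J(2)] J(2) by (cases "T = 0") auto
    have "t \<in> J \<longleftrightarrow> 0 \<le> t \<and> t < T" for t
      using le[of t] less[of t] False J(3) by (cases "t = T") auto
    then have "J = {0..<T}"
      by (intro set_eqI) simp
    with \<open>0 < T\<close> show thesis by (rule that(3))
  qed
qed

section \<open>Positive trajectories of the desingularized field\<close>

lemma continuous_on_desing_field: "continuous_on S (desing_field c)"
  unfolding desing_field_def case_prod_unfold by (intro continuous_intros)

lemma solves_on_desing_field_iff:
  "solves_on (desing_field c) \<gamma> J \<longleftrightarrow>
    (\<forall>t\<in>J. ((\<lambda>t. fst (\<gamma> t)) has_real_derivative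
              c * snd (\<gamma> t) * fst (\<gamma> t) - fst (\<gamma> t) ^ 3) (at t within J) \<and>
           ((\<lambda>t. snd (\<gamma> t)) has_real_derivative
              - snd (\<gamma> t) + snd (\<gamma> t) * (c * snd (\<gamma> t) - (fst (\<gamma> t))\<^sup>2)) (at t within J))"
proof -
  have "(\<gamma> has_vector_derivative v) (at t within J) \<longleftrightarrow>
      ((\<lambda>t. fst (\<gamma> t)) has_vector_derivative fst v) (at t within J) \<and> ((\<lambda>t. snd (\<gamma> t)) has_vector_derivative snd v) (at t within J)"
    for v :: "real \<times> real" and t
  proof
    assume "(\<gamma> has_vector_derivative v) (at t within J)"
    then show "((\<lambda>t. fst (\<gamma> t)) has_vector_derivative fst v) (at t within J) \<and> ((\<lambda>t. snd (\<gamma> t)) has_vector_derivative snd v) (at t within J)"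
      unfolding has_vector_derivative_def
      using has_derivative_fst[of \<gamma> "\<lambda>h. h *\<^sub>R v" "at t within J"] has_derivative_snd[of \<gamma> "\<lambda>h. h *\<^sub>R v" "at t within J"] by simp
  next
    assume "((\<lambda>t. fst (\<gamma> t)) has_vector_derivative fst v) (at t within J) \<and> ((\<lambda>t. snd (\<gamma> t)) has_vector_derivative snd v) (at t within J)"
    then have "((\<lambda>t. (fst (\<gamma> t), snd (\<gamma> t))) has_derivative (\<lambda>h. (h *\<^sub>R fst v, h *\<^sub>R snd v))) (at t within J)"
      unfolding has_vector_derivative_def by (elim conjE) (rule has_derivative_Pair)
    then show "(\<gamma> has_vector_derivative v) (at t within J)"
      unfolding has_vector_derivative_def by (simp add: scaleR_prod_def)
  qed
  then show ?thesis
    by (simp add: solves_on_def desing_field_def case_prod_unfold has_real_derivative_iff_has_vector_derivative)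
qed

text \<open>Local existence is obtained by an explicit quadrature. In terms of the profile variables,
  \<open>w = \<psi> + c \<phi>\<close> satisfies \<open>dw/d\<tau> = 1 / \<psi> < 0\<close>, so \<open>w\<close> can replace time, and then \<open>u = 1 / \<phi>\<close> solves the
  linear equation \<open>du/dw = w u - c\<close>. Because \<open>d\<phi>/d\<tau> = - \<phi>\<close>, the time is \<open>ln u\<close> up to a constant;
  inverting it gives the solution as a function of \<open>\<tau>\<close>.\<close>

lemma desing_field_local_solution:
  assumes l: "l > 0" and x: "x > 0"
  shows "\<exists>\<epsilon>>0. \<exists>\<gamma>. \<gamma> 0 = (l, x) \<and> solves_on (desing_field c) \<gamma> {0..\<epsilon>}"
proof -
  \<comment> \<open>\<open>w\<close> is the value of \<open>\<psi> + c \<phi>\<close> at the initial point; the new variable is \<open>v = w - (\<psi> + c \<phi>)\<close>,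
    which increases with time. In it, \<open>U\<close> is \<open>1 / \<phi>\<close>, \<open>G\<close> an integrating factor for
    \<open>U' = c + (v - w) U\<close>, and \<open>P\<close> is \<open>- \<psi> = 1 / \<lambda>\<close>.\<close>
  define w where "w = c * x / l - 1 / l"
  define G where "G v = exp (- (v - w)\<^sup>2 / 2)" for v
  define U where "U v = inverse (G v) * (l / x * G 0 + c * integral {0..v} G)" for v
  define P where "P v = c / U v + v - w" for v
  have G: "G v > 0" for v
    by (simp add: G_def)
  have dG: "(G has_real_derivative - (v - w) * G v) (at v within S)" for v S
    unfolding G_def by (auto intro!: derivative_eq_intros simp: field_simps power2_eq_square)
  have "continuous_on {0..1} G"
    unfolding G_def by (intro continuous_intros) auto
  then have dI: "((\<lambda>v. integral {0..v} G) has_real_derivative G v) (at v within {0..1})" if "v \<in> {0..1}" for v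
    using integral_has_vector_derivative[OF _ that] by (simp add: has_real_derivative_iff_has_vector_derivative)
  have dU: "(U has_real_derivative c + (v - w) * U v) (at v within {0..1})" if v: "v \<in> {0..1}" for v
    unfolding U_def using G[of v] x
    by (auto intro!: derivative_eq_intros dI[OF v] dG simp: field_simps power2_eq_square)
  have U0: "U 0 = l / x"
    using G[of 0] by (simp add: U_def)
  have P0: "P 0 = 1 / l"
    using l x by (simp add: P_def U0 w_def field_simps)
  have "(U \<longlongrightarrow> U 0) (at 0 within {0..1})"
    using DERIV_continuous[OF dU[of 0]] by (simp add: continuous_within)
  moreover from this have "(P \<longlongrightarrow> P 0) (at 0 within {0..1})"
    unfolding P_def by (intro tendsto_intros) (use U0 l x in auto)
  ultimately have "\<forall>\<^sub>F v in at 0 within {0..1}. U v > 0 \<and> P v > 0"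
    using U0 P0 l x by (intro eventually_conj order_tendstoD(1)[of _ "l / x"] order_tendstoD(1)[of _ "1 / l"]) auto
  then obtain d where d: "d > 0" "\<And>v. v \<in> {0..1} \<Longrightarrow> v \<noteq> 0 \<Longrightarrow> v < d \<Longrightarrow> U v > 0 \<and> P v > 0"
    unfolding eventually_at by (auto simp: dist_real_def)
  define \<delta> where "\<delta> = min (d / 2) 1"
  let ?I = "{0..\<delta>}"
  have \<delta>: "0 < \<delta>" "?I \<subseteq> {0..1}"
    using d(1) by (auto simp: \<delta>_def)
  have UP: "U v > 0" "P v > 0" if "v \<in> ?I" for v
  proof -
    have "U v > 0 \<and> P v > 0"
      using that d U0 P0 l x by (cases "v = 0") (auto simp: \<delta>_def)
    then show "U v > 0" "P v > 0" by auto
  qed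
  have dU: "(U has_real_derivative P v * U v) (at v within ?I)" if "v \<in> ?I" for v
  proof -
    have "c + (v - w) * U v = P v * U v"
      using UP(1)[OF that] by (simp add: P_def field_simps)
    moreover have "v \<in> {0..1}" using that \<delta>(2) by blast
    ultimately show ?thesis
      using DERIV_subset[OF dU \<delta>(2)] by metis
  qed
  have dP: "(P has_real_derivative 1 - c * P v / U v) (at v within ?I)" if "v \<in> ?I" for v
    unfolding P_def using UP(1)[OF that]
    by (auto intro!: derivative_eq_intros dU[OF that] simp: P_def field_simps power2_eq_square)
  \<comment> \<open>The time at which \<open>v\<close> is reached, from \<open>\<phi> = (x / l) exp (- \<tau>)\<close>.\<close>
  define F where "F v = ln (U v) - ln (l / x)" for v
  have dF: "(F has_real_derivative P v) (at v within ?I)" if "v \<in> ?I" for v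
    unfolding F_def using UP[OF that]
    by (auto intro!: derivative_eq_intros dU[OF that])
  have I: "is_interval ?I"
    by (rule is_interval_cc)
  have sm: "strict_mono_on ?I F"
    using I dF UP(2) by (rule strict_mono_on_interval_if_deriv_pos)
  have F0: "F 0 = 0"
    by (simp add: F_def U0)
  have img: "F ` ?I = {0..F \<delta>}"
  proof (intro subset_antisym subsetI)
    fix y assume "y \<in> F ` ?I"
    then obtain v where v: "v \<in> ?I" "y = F v" by blast
    then have "F 0 \<le> F v" "F v \<le> F \<delta>"
      using strict_mono_on_leD[OF sm] \<delta>(1) by auto
    then show "y \<in> {0..F \<delta>}" using v F0 by simp
  next
    fix y assume "y \<in> {0..F \<delta>}"
    moreover have "continuous_on ?I F"
      using dF by (rule DERIV_continuous_on)
    ultimately show "y \<in> F ` ?I"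
      using IVT'[of F 0 y \<delta>] F0 \<delta>(1) by auto
  qed
  define g where "g = the_inv_into ?I F"
  have gF: "g (F v) = v" if "v \<in> ?I" for v
    unfolding g_def using strict_mono_on_imp_inj_on[OF sm] that by (rule the_inv_into_f_f)
  have dg: "(g has_real_derivative 1 / P v) (at (F v) within {0..F \<delta>})" if "v \<in> ?I" for v
    using increasing_inverse_has_derivative[OF I dF UP(2) that] unfolding img g_def .
  define \<gamma> where "\<gamma> t = (1 / P (g t), 1 / (P (g t) * U (g t)))" for t
  have "solves_on (desing_field c) \<gamma> {0..F \<delta>}"
    unfolding solves_on_desing_field_iff
  proof
    fix t assume "t \<in> {0..F \<delta>}"
    then obtain v where v: "v \<in> ?I" and t: "t = F v"
      using img by blast
    have g: "g t = v" using gF[OF v] t by simp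
    have ran: "g ` {0..F \<delta>} = ?I"
      unfolding img[symmetric] image_image using gF by simp
    have PU: "P v \<noteq> 0" "U v \<noteq> 0" using UP[OF v] by auto
    have dPg: "((\<lambda>t. P (g t)) has_real_derivative (1 - c * P v / U v) * (1 / P v)) (at t within {0..F \<delta>})"
      using DERIV_image_chain[of P "1 - c * P v / U v" g t "{0..F \<delta>}" "1 / P v"] dP[OF v] dg[OF v] by (simp add: ran g t[symmetric] o_def)
    have dUg: "((\<lambda>t. U (g t)) has_real_derivative (P v * U v) * (1 / P v)) (at t within {0..F \<delta>})"
      using DERIV_image_chain[of U "P v * U v" g t "{0..F \<delta>}" "1 / P v"] dU[OF v] dg[OF v] by (simp add: ran g t[symmetric] o_def)
    have 1: "((\<lambda>t. fst (\<gamma> t)) has_real_derivative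
              c * snd (\<gamma> t) * fst (\<gamma> t) - fst (\<gamma> t) ^ 3) (at t within {0..F \<delta>})"
      unfolding \<gamma>_def fst_conv snd_conv using PU
      by (auto intro!: derivative_eq_intros dPg simp: g divide_simps)
        (auto simp: algebra_simps power2_eq_square power3_eq_cube)
    have 2: "((\<lambda>t. snd (\<gamma> t)) has_real_derivative
              - snd (\<gamma> t) + snd (\<gamma> t) * (c * snd (\<gamma> t) - (fst (\<gamma> t))\<^sup>2)) (at t within {0..F \<delta>})"
      unfolding \<gamma>_def fst_conv snd_conv using PU
      by (auto intro!: derivative_eq_intros dPg dUg simp: g divide_simps)
        (auto simp: algebra_simps power2_eq_square power3_eq_cube)
    from 1 2 show "((\<lambda>t. fst (\<gamma> t)) has_real_derivative
              c * snd (\<gamma> t) * fst (\<gamma> t) - fst (\<gamma> t) ^ 3) (at t within {0..F \<delta>}) \<and>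
        ((\<lambda>t. snd (\<gamma> t)) has_real_derivative
              - snd (\<gamma> t) + snd (\<gamma> t) * (c * snd (\<gamma> t) - (fst (\<gamma> t))\<^sup>2)) (at t within {0..F \<delta>})"
      by blast
  qed
  moreover have "\<gamma> 0 = (l, x)"
    using gF[of 0] \<delta>(1) l x by (simp add: \<gamma>_def F0 P0 U0)
  moreover have "F \<delta> > 0"
    using strict_mono_onD[OF sm, of 0 \<delta>] \<delta>(1) F0 by simp
  ultimately show ?thesis by blast
qed

text \<open>With \<open>y = 1 / x - c\<close> one has \<open>y' = y + \<lambda>\<^sup>2 / x \<ge> y\<close>. Hence \<open>y exp (- t)\<close> increases, and \<open>y\<close>, being
  positive initially, never drops below its initial value. This bounds \<open>x\<close> without a continuation argument.\<close>

lemma positive_solution_x_le_initial: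
  assumes J: "is_interval J" "0 \<in> J" "J \<subseteq> {0..}"
    and sol: "solves_on (desing_field c) \<gamma> J"
    and pos: "\<And>t. t \<in> J \<Longrightarrow> snd (\<gamma> t) > 0"
    and small: "c * snd (\<gamma> 0) < 1" and t: "t \<in> J"
  shows "snd (\<gamma> t) \<le> snd (\<gamma> 0)"
proof -
  define x where "x t = snd (\<gamma> t)" for t
  define l where "l t = fst (\<gamma> t)" for t
  have x: "(x has_real_derivative - x t + x t * (c * x t - (l t)\<^sup>2)) (at t within J)" "x t > 0" if "t \<in> J" for t
    using sol that pos unfolding solves_on_desing_field_iff x_def l_def by auto
  have "antimono_on J (\<lambda>t. (c - 1 / x t) * exp (- t))"
  proof (rule antimono_on_interval_if_deriv_nonpos[OF J(1)])
    fix t assume t: "t \<in> J"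
    show "((\<lambda>t. (c - 1 / x t) * exp (- t)) has_real_derivative - ((l t)\<^sup>2 / x t * exp (- t))) (at t within J)"
      using x(2)[OF t] by (auto intro!: derivative_eq_intros x(1)[OF t] simp: field_simps power2_eq_square)
    show "- ((l t)\<^sup>2 / x t * exp (- t)) \<le> 0"
      using x(2)[OF t] by simp
  qed
  moreover have "0 \<le> t" using t J(3) by auto
  ultimately have "(c - 1 / x t) * exp (- t) \<le> c - 1 / x 0"
    using monotone_onD[of J "(\<le>)" "(\<ge>)" _ 0 t] J(2) t by fastforce
  moreover have neg: "c - 1 / x 0 < 0"
    using small x(2)[OF J(2)] by (simp add: x_def field_simps)
  ultimately have "c - 1 / x t \<le> (c - 1 / x 0) * exp t"
    by (simp add: exp_minus field_simps)
  also have "\<dots> \<le> (c - 1 / x 0) * 1"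
    using neg \<open>0 \<le> t\<close> by (intro mult_left_mono_neg) auto
  finally have "1 / x 0 \<le> 1 / x t" by simp
  then show ?thesis
    using x(2)[OF t] x(2)[OF J(2)] by (simp add: x_def field_simps)
qed

text \<open>The strip \<open>\<bar>c x\<bar> < 1 / 2\<close> is forward invariant for positive solutions, and there the term \<open>- x\<close>
  dominates, which makes \<open>x\<close> decay exponentially.\<close>

lemma positive_solution_strip_bounds:
  assumes J: "is_interval J" "0 \<in> J" "J \<subseteq> {0..}"
    and sol: "solves_on (desing_field c) \<gamma> J"
    and pos: "\<And>t. t \<in> J \<Longrightarrow> snd (\<gamma> t) > 0"
    and small: "\<bar>c * snd (\<gamma> 0)\<bar> < 1 / 2" and t: "t \<in> J"
  shows "\<bar>c * snd (\<gamma> t)\<bar> < 1 / 2"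
    and "- snd (\<gamma> t) + snd (\<gamma> t) * (c * snd (\<gamma> t) - (fst (\<gamma> t))\<^sup>2) \<le> - snd (\<gamma> t) / 2"
proof -
  have "snd (\<gamma> t) \<le> snd (\<gamma> 0)"
    using small by (intro positive_solution_x_le_initial[OF J sol pos _ t]) auto
  then have "\<bar>c * snd (\<gamma> t)\<bar> \<le> \<bar>c * snd (\<gamma> 0)\<bar>"
    using pos[OF t] by (simp add: abs_mult mult_left_mono)
  then show *: "\<bar>c * snd (\<gamma> t)\<bar> < 1 / 2"
    using small by linarith
  have "c * snd (\<gamma> t) - (fst (\<gamma> t))\<^sup>2 \<le> 1 / 2"
    using * zero_le_power2[of "fst (\<gamma> t)"] by linarith
  then have "snd (\<gamma> t) * (c * snd (\<gamma> t) - (fst (\<gamma> t))\<^sup>2) \<le> snd (\<gamma> t) * (1 / 2)"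
    using pos[OF t] by (intro mult_left_mono) auto
  then show "- snd (\<gamma> t) + snd (\<gamma> t) * (c * snd (\<gamma> t) - (fst (\<gamma> t))\<^sup>2) \<le> - snd (\<gamma> t) / 2"
    by simp
qed

text \<open>Otherwise the time interval is bounded, and whether or not it contains its right endpoint, the
  solution can be extended, against maximality.\<close>

lemma positive_trajectory_in_strip_is_global:
  assumes \<gamma>: "positive_trajectory_from c W \<gamma> J" and small: "\<bar>c * snd (\<gamma> 0)\<bar> < 1 / 2"
  shows "J = {0..}"
proof -
  have J: "is_interval J" "0 \<in> J" "J \<subseteq> {0..}" and sol: "solves_on (desing_field c) \<gamma> J"
    and max: "\<And>J' \<gamma>'. is_interval J' \<Longrightarrow> J \<subseteq> J' \<Longrightarrow> J' \<subseteq> {0..} \<Longrightarrow> solves_on (desing_field c) \<gamma>' J'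
      \<Longrightarrow> \<forall>t\<in>J. \<gamma>' t = \<gamma> t \<Longrightarrow> J' = J"
    and pos: "\<And>t. t \<in> J \<Longrightarrow> fst (\<gamma> t) > 0" "\<And>t. t \<in> J \<Longrightarrow> snd (\<gamma> t) > 0"
    using \<gamma> unfolding positive_trajectory_from_def forward_trajectory_def by auto
  have bounds: "\<bar>c * snd (\<gamma> t)\<bar> < 1 / 2"
    "- snd (\<gamma> t) + snd (\<gamma> t) * (c * snd (\<gamma> t) - (fst (\<gamma> t))\<^sup>2) \<le> - snd (\<gamma> t) / 2" if "t \<in> J" for t
    using positive_solution_strip_bounds[of J c \<gamma> t] J sol pos(2) small that by blast+
  show ?thesis
  proof (cases rule: forward_interval_cases[OF J])
    case 1
    then show ?thesis .
  next
    case (2 T)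
    have "T \<in> J" using 2 by simp
    then obtain \<epsilon> \<delta> where \<epsilon>: "\<epsilon> > 0" and \<delta>: "\<delta> 0 = \<gamma> T" "solves_on (desing_field c) \<delta> {0..\<epsilon>}"
      using desing_field_local_solution[of "fst (\<gamma> T)" "snd (\<gamma> T)" c] pos by auto
    \<comment> \<open>A solution that starts at the endpoint can be appended.\<close>
    have "{0..T + \<epsilon>} = J"
    proof (rule max)
      show "solves_on (desing_field c) (\<lambda>t. if t \<le> T then \<gamma> t else \<delta> (t - T)) {0..T + \<epsilon>}"
        using sol \<epsilon> \<delta> 2 by (intro solves_on_concatenate continuous_on_desing_field) auto
    qed (use 2 \<epsilon> in \<open>auto simp: is_interval_cc\<close>)
    then have "T + \<epsilon> \<in> J" using 2 \<epsilon> by auto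
    then show ?thesis using 2 \<epsilon> by simp
  next
    case (3 T)
    \<comment> \<open>Both \<open>x\<close> and \<open>\<lambda> exp (- t / 2)\<close> are positive and decreasing, so \<open>\<gamma>\<close> converges at \<open>T\<close> and the
      missing endpoint can be added.\<close>
    define x where "x t = snd (\<gamma> t)" for t
    define l where "l t = fst (\<gamma> t)" for t
    have dl: "(l has_real_derivative c * x t * l t - l t ^ 3) (at t within J)"
      and dx: "(x has_real_derivative - x t + x t * (c * x t - (l t)\<^sup>2)) (at t within J)" if "t \<in> J" for t
      using sol that unfolding solves_on_desing_field_iff x_def l_def by auto
    have pos': "l t > 0" "x t > 0" if "t \<in> J" for t
      using pos that by (auto simp: l_def x_def)
    have "antimono_on J x"
      using J(1) dx
    proof (rule antimono_on_interval_if_deriv_nonpos)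
      show "- x t + x t * (c * x t - (l t)\<^sup>2) \<le> 0" if "t \<in> J" for t
        using bounds(2)[OF that] pos'(2)[OF that] unfolding x_def l_def by linarith
    qed
    then obtain x1 where x1: "(x \<longlongrightarrow> x1) (at_left T)"
      using decreasing_bounded_below_tendsto_at_left[of 0 T x 0] 3 pos' by (auto simp: less_imp_le)
    have "antimono_on J (\<lambda>t. l t * exp (- t / 2))"
    proof (rule antimono_on_interval_if_deriv_nonpos[OF J(1)])
      fix t assume t: "t \<in> J"
      show "((\<lambda>t. l t * exp (- t / 2)) has_real_derivative (c * x t - 1 / 2 - (l t)\<^sup>2) * (l t * exp (- t / 2))) (at t within J)"
        by (auto intro!: derivative_eq_intros dl[OF t] simp: field_simps power2_eq_square power3_eq_cube)
      have "c * x t - 1 / 2 - (l t)\<^sup>2 \<le> 0"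
        using bounds(1)[OF t] zero_le_power2[of "l t"] unfolding x_def by linarith
      then show "(c * x t - 1 / 2 - (l t)\<^sup>2) * (l t * exp (- t / 2)) \<le> 0"
        using pos'(1)[OF t] by (intro mult_nonpos_nonneg) auto
    qed
    then obtain m where "((\<lambda>t. l t * exp (- t / 2)) \<longlongrightarrow> m) (at_left T)"
      using decreasing_bounded_below_tendsto_at_left[of 0 T "\<lambda>t. l t * exp (- t / 2)" 0] 3 pos' by (auto simp: less_imp_le)
    then have "((\<lambda>t. l t * exp (- t / 2) * exp (t / 2)) \<longlongrightarrow> m * exp (T / 2)) (at_left T)"
      by (intro tendsto_intros) auto
    then have l1: "(l \<longlongrightarrow> m * exp (T / 2)) (at_left T)"
      by (simp add: mult.assoc flip: exp_add)
    have "(\<gamma> \<longlongrightarrow> (m * exp (T / 2), x1)) (at_left T)"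
      using tendsto_Pair[OF l1 x1] by (simp add: l_def x_def)
    then have "solves_on (desing_field c) (\<gamma>(T := (m * exp (T / 2), x1))) {0..T}"
      using sol 3 by (intro solves_on_extend_to_limit continuous_on_desing_field) auto
    then have "{0..T} = J"
      by (rule max[rotated 3]) (use 3 in \<open>auto simp: is_interval_cc\<close>)
    then have "T \<in> J" using 3 by auto
    then show ?thesis using 3 by simp
  qed
qed

section \<open>Quenching solutions and positive trajectories\<close>

lemma quenching_solution_phase_limit:
  assumes "(\<phi> \<longlongrightarrow> (0 :: real)) F" "filterlim \<psi> at_bot F"
  shows "((\<lambda>\<xi>. - 1 / \<psi> \<xi>) \<longlongrightarrow> (0 :: real)) F" "((\<lambda>\<xi>. - \<phi> \<xi> / \<psi> \<xi>) \<longlongrightarrow> 0) F"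
proof -
  have inf: "filterlim \<psi> at_infinity F"
    using assms(2) by (rule filterlim_at_bot_imp_at_infinity)
  show "((\<lambda>\<xi>. - 1 / \<psi> \<xi>) \<longlongrightarrow> 0) F"
    by (rule tendsto_divide_0[OF tendsto_const inf])
  have "((\<lambda>\<xi>. - \<phi> \<xi>) \<longlongrightarrow> - 0) F"
    by (intro tendsto_intros assms)
  then show "((\<lambda>\<xi>. - \<phi> \<xi> / \<psi> \<xi>) \<longlongrightarrow> 0) F"
    by (rule tendsto_divide_0[OF _ inf])
qed

text \<open>The profile equation in the coordinates \<open>\<lambda> = - 1 / \<psi>\<close>, \<open>x = - \<phi> / \<psi>\<close>, still in the variable
  \<open>\<xi>\<close>. Multiplication by \<open>x = d\<xi>/d\<tau>\<close> gives the desingularized field.\<close>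

lemma profile_time_field:
  assumes "profile_solution c I \<phi> \<psi>" "\<xi> \<in> I" "\<psi> \<xi> \<noteq> 0"
  shows "((\<lambda>\<xi>. - 1 / \<psi> \<xi>) has_real_derivative (- c * \<psi> \<xi> - 1 / \<phi> \<xi>) / (\<psi> \<xi>)\<^sup>2) (at \<xi> within I)"
    and "((\<lambda>\<xi>. - \<phi> \<xi> / \<psi> \<xi>) has_real_derivative
          - 1 + c * (- \<phi> \<xi> / \<psi> \<xi>) - (- 1 / \<psi> \<xi>)\<^sup>2) (at \<xi> within I)"
proof -
  have pos: "\<phi> \<xi> > 0"
    and d: "(\<phi> has_real_derivative \<psi> \<xi>) (at \<xi> within I)"
      "(\<psi> has_real_derivative - c * \<psi> \<xi> - inverse (\<phi> \<xi>)) (at \<xi> within I)"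
    using assms unfolding profile_solution_def by auto
  show "((\<lambda>\<xi>. - 1 / \<psi> \<xi>) has_real_derivative (- c * \<psi> \<xi> - 1 / \<phi> \<xi>) / (\<psi> \<xi>)\<^sup>2) (at \<xi> within I)"
    using assms(3) pos
    by (auto intro!: derivative_eq_intros d simp: power2_eq_square divide_inverse)
  show "((\<lambda>\<xi>. - \<phi> \<xi> / \<psi> \<xi>) has_real_derivative
          - 1 + c * (- \<phi> \<xi> / \<psi> \<xi>) - (- 1 / \<psi> \<xi>)\<^sup>2) (at \<xi> within I)"
    using assms(3) pos
    by (auto intro!: derivative_eq_intros d simp: divide_simps) (auto simp: algebra_simps power2_eq_square)
qed

text \<open>Since \<open>(\<lambda>, x) \<rightarrow> (0, 0)\<close>, the solution eventually enters \<open>W\<close>. The new time is \<open>- ln \<phi>\<close> up to a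
  constant; it tends to infinity as \<open>\<phi> \<rightarrow> 0\<close>, so the trajectory lives on \<open>[0, \<infinity>)\<close> and is automatically
  maximal.\<close>

lemma trajectory_of_quenching_solution:
  assumes q: "quenching_solution c a m \<phi> \<psi>" and W: "open W" "(0, 0) \<in> W"
  shows "\<exists>\<xi>\<^sub>0\<in>{a..<m}. \<exists>\<gamma> J. positive_trajectory_from c W \<gamma> J \<and> corresponds \<phi> \<psi> \<xi>\<^sub>0 m \<gamma> J"
proof -
  have am: "a < m" and prof: "profile_solution c {a..<m} \<phi> \<psi>"
    and \<phi>0: "(\<phi> \<longlongrightarrow> 0) (at_left m)" and \<psi>: "filterlim \<psi> at_bot (at_left m)"
    using q unfolding quenching_solution_def by auto
  define L where "L \<xi> = (- 1 / \<psi> \<xi>, - \<phi> \<xi> / \<psi> \<xi>)" for \<xi>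
  have "(L \<longlongrightarrow> (0, 0)) (at_left m)"
    unfolding L_def by (intro tendsto_Pair quenching_solution_phase_limit[OF \<phi>0 \<psi>])
  then have "\<forall>\<^sub>F \<xi> in at_left m. L \<xi> \<in> W"
    using W by (rule topological_tendstoD)
  moreover have "\<forall>\<^sub>F \<xi> in at_left m. \<psi> \<xi> < 0"
    using \<psi> by (auto simp: filterlim_at_bot_dense)
  ultimately have "\<forall>\<^sub>F \<xi> in at_left m. L \<xi> \<in> W \<and> \<psi> \<xi> < 0"
    by (rule eventually_conj)
  then obtain b where b: "b < m" "\<And>\<xi>. b < \<xi> \<Longrightarrow> \<xi> < m \<Longrightarrow> L \<xi> \<in> W \<and> \<psi> \<xi> < 0"
    unfolding eventually_at_left_field by auto
  define \<xi>\<^sub>0 where "\<xi>\<^sub>0 = max a ((b + m) / 2)"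
  have \<xi>\<^sub>0: "a \<le> \<xi>\<^sub>0" "b < \<xi>\<^sub>0" "\<xi>\<^sub>0 < m"
    using am b(1) by (auto simp: \<xi>\<^sub>0_def less_max_iff_disj field_simps)
  let ?I = "{\<xi>\<^sub>0..<m}"
  have sub: "?I \<subseteq> {a..<m}" using \<xi>\<^sub>0 by auto
  have prof': "profile_solution c ?I \<phi> \<psi>"
    using prof sub DERIV_subset unfolding profile_solution_def by (meson subsetD)
  have pos: "\<phi> \<xi> > 0" "\<psi> \<xi> < 0" if "\<xi> \<in> ?I" for \<xi>
    using prof' b(2)[of \<xi>] \<xi>\<^sub>0 that unfolding profile_solution_def by auto
  \<comment> \<open>The time \<open>\<tau>\<close> as a function of \<open>\<xi>\<close>, since \<open>d\<phi>/d\<tau> = - \<phi>\<close>.\<close>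
  define F where "F \<xi> = ln (\<phi> \<xi>\<^sub>0) - ln (\<phi> \<xi>)" for \<xi>
  have dF: "(F has_real_derivative - \<psi> \<xi> / \<phi> \<xi>) (at \<xi> within ?I)" if "\<xi> \<in> ?I" for \<xi>
  proof -
    have "(\<phi> has_real_derivative \<psi> \<xi>) (at \<xi> within ?I)"
      using prof' that unfolding profile_solution_def by blast
    then show ?thesis
      unfolding F_def using pos[OF that] by (auto intro!: derivative_eq_intros)
  qed
  have dF_pos: "- \<psi> \<xi> / \<phi> \<xi> > 0" if "\<xi> \<in> ?I" for \<xi>
    using pos[OF that] by (intro divide_pos_pos) auto
  have I: "is_interval ?I" by (rule is_interval_co)
  have sm: "strict_mono_on ?I F"
    using I dF dF_pos by (rule strict_mono_on_interval_if_deriv_pos)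
  have F0: "F \<xi>\<^sub>0 = 0" by (simp add: F_def)
  have img: "F ` ?I = {0..}"
  proof (intro subset_antisym subsetI)
    fix y assume "y \<in> F ` ?I"
    then obtain \<xi> where "\<xi> \<in> ?I" "y = F \<xi>" by blast
    then show "y \<in> {0..}"
      using strict_mono_on_leD[OF sm, of \<xi>\<^sub>0 \<xi>] F0 by auto
  next
    fix y :: real assume y: "y \<in> {0..}"
    have I_ev: "\<forall>\<^sub>F \<xi> in at_left m. \<xi> \<in> ?I"
      using eventually_at_left_real[OF \<xi>\<^sub>0(3)] by eventually_elim auto
    have "\<forall>\<^sub>F \<xi> in at_left m. \<phi> \<xi> < \<phi> \<xi>\<^sub>0 * exp (- y)"
      using \<phi>0 pos(1)[of \<xi>\<^sub>0] \<xi>\<^sub>0 by (intro order_tendstoD(2)[OF \<phi>0]) auto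
    with I_ev have "\<forall>\<^sub>F \<xi> in at_left m. \<xi> \<in> ?I \<and> \<phi> \<xi> < \<phi> \<xi>\<^sub>0 * exp (- y)"
      by (rule eventually_conj)
    then obtain \<xi> where \<xi>: "\<xi> \<in> ?I" "\<phi> \<xi> < \<phi> \<xi>\<^sub>0 * exp (- y)"
      by (metis (no_types, lifting) eventually_happens' trivial_limit_at_left_real)
    then have "ln (\<phi> \<xi>) < ln (\<phi> \<xi>\<^sub>0 * exp (- y))"
      using pos(1)[OF \<xi>(1)] pos(1)[of \<xi>\<^sub>0] \<xi>\<^sub>0 by (subst ln_less_cancel_iff) auto
    then have "y \<le> F \<xi>"
      using pos(1)[of \<xi>\<^sub>0] \<xi>\<^sub>0 by (simp add: F_def ln_mult)
    moreover have "continuous_on {\<xi>\<^sub>0..\<xi>} F"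
      using \<xi>(1) by (intro continuous_on_subset[OF DERIV_continuous_on[OF dF]]) auto
    ultimately obtain \<eta> where "\<xi>\<^sub>0 \<le> \<eta>" "\<eta> \<le> \<xi>" "F \<eta> = y"
      using IVT'[of F \<xi>\<^sub>0 y \<xi>] F0 y \<xi>(1) by auto
    then show "y \<in> F ` ?I"
      using \<xi>(1) by auto
  qed
  define s where "s = the_inv_into ?I F"
  have bij_F: "bij_betw F ?I {0..}"
    using strict_mono_on_imp_inj_on[OF sm] img by (simp add: bij_betw_def)
  have sF: "s (F \<xi>) = \<xi>" if "\<xi> \<in> ?I" for \<xi>
    unfolding s_def using strict_mono_on_imp_inj_on[OF sm] that by (rule the_inv_into_f_f)
  have bij: "bij_betw s {0..} ?I"
    unfolding s_def by (rule bij_betw_the_inv_into[OF bij_F])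
  have s0: "s 0 = \<xi>\<^sub>0"
    using sF[of \<xi>\<^sub>0] \<xi>\<^sub>0 F0 by simp
  have s_mem: "s t \<in> ?I" if "t \<in> {0..}" for t
    using bij_betwE[OF bij] that by blast
  have ds: "(s has_real_derivative - \<phi> (s t) / \<psi> (s t)) (at t within {0..})" if t: "t \<in> {0..}" for t
  proof -
    obtain \<xi> where \<xi>: "\<xi> \<in> ?I" "t = F \<xi>"
      using t img by blast
    have "(s has_real_derivative 1 / (- \<psi> \<xi> / \<phi> \<xi>)) (at (F \<xi>) within {0..})"
      using increasing_inverse_has_derivative[OF I dF dF_pos \<xi>(1)] unfolding img s_def .
    then show ?thesis
      using sF[OF \<xi>(1)] \<xi>(2) by simp
  qed
  define \<gamma> where "\<gamma> t = L (s t)" for t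
  have chain: "((\<lambda>t. f (s t)) has_real_derivative D * (- \<phi> (s t) / \<psi> (s t))) (at t within {0..})"
    if "(f has_real_derivative D) (at (s t) within ?I)" "t \<in> {0..}" for f D t
    using DERIV_image_chain[of f D s t "{0..}" "- \<phi> (s t) / \<psi> (s t)"] ds[OF that(2)] that(1) bij_betw_imp_surj_on[OF bij]
    by (simp add: o_def)
  have "solves_on (desing_field c) \<gamma> {0..}"
    unfolding solves_on_desing_field_iff
  proof
    fix t :: real assume t: "t \<in> {0..}"
    note p = pos[OF s_mem[OF t]]
    have "\<psi> (s t) \<noteq> 0" using p by simp
    note d = profile_time_field[OF prof' s_mem[OF t] this]
    show "((\<lambda>t. fst (\<gamma> t)) has_real_derivative
            c * snd (\<gamma> t) * fst (\<gamma> t) - fst (\<gamma> t) ^ 3) (at t within {0..}) \<and>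
          ((\<lambda>t. snd (\<gamma> t)) has_real_derivative
            - snd (\<gamma> t) + snd (\<gamma> t) * (c * snd (\<gamma> t) - (fst (\<gamma> t))\<^sup>2)) (at t within {0..})"
      unfolding \<gamma>_def L_def fst_conv snd_conv
    proof
      have eq: "(- c * \<psi> (s t) - 1 / \<phi> (s t)) / (\<psi> (s t))\<^sup>2 * (- \<phi> (s t) / \<psi> (s t))
          = c * (- \<phi> (s t) / \<psi> (s t)) * (- 1 / \<psi> (s t)) - (- 1 / \<psi> (s t)) ^ 3"
        using p by (simp add: divide_simps) (simp add: algebra_simps power2_eq_square power3_eq_cube)
      show "((\<lambda>t. - 1 / \<psi> (s t)) has_real_derivative
          c * (- \<phi> (s t) / \<psi> (s t)) * (- 1 / \<psi> (s t)) - (- 1 / \<psi> (s t)) ^ 3) (at t within {0..})"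
        using chain[OF d(1) t] unfolding eq .
      have eq: "(- 1 + c * (- \<phi> (s t) / \<psi> (s t)) - (- 1 / \<psi> (s t))\<^sup>2) * (- \<phi> (s t) / \<psi> (s t))
          = - (- \<phi> (s t) / \<psi> (s t)) + (- \<phi> (s t) / \<psi> (s t)) * (c * (- \<phi> (s t) / \<psi> (s t)) - (- 1 / \<psi> (s t))\<^sup>2)"
        by (simp only: algebra_simps)
      show "((\<lambda>t. - \<phi> (s t) / \<psi> (s t)) has_real_derivative
          - (- \<phi> (s t) / \<psi> (s t)) + (- \<phi> (s t) / \<psi> (s t)) * (c * (- \<phi> (s t) / \<psi> (s t)) - (- 1 / \<psi> (s t))\<^sup>2))
          (at t within {0..})"
        using chain[OF d(2) t] unfolding eq .
    qed
  qed
  then have "forward_trajectory (desing_field c) \<gamma> {0..}"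
    unfolding forward_trajectory_def by (auto simp: is_interval_ci)
  moreover have "fst (\<gamma> t) > 0 \<and> snd (\<gamma> t) > 0" if "t \<in> {0..}" for t
    using pos[OF s_mem[OF that]] by (simp add: \<gamma>_def L_def divide_pos_neg divide_neg_neg)
  moreover have "\<gamma> 0 \<in> W"
    using b(2)[of \<xi>\<^sub>0] \<xi>\<^sub>0 by (simp add: \<gamma>_def s0)
  ultimately have "positive_trajectory_from c W \<gamma> {0..}"
    unfolding positive_trajectory_from_def by blast
  moreover have "corresponds \<phi> \<psi> \<xi>\<^sub>0 m \<gamma> {0..}"
    unfolding corresponds_def
  proof (intro exI[of _ s] conjI ballI)
    fix t :: real assume t: "t \<in> {0..}"
    show "(s has_real_derivative snd (\<gamma> t)) (at t within {0..})"
      using ds[OF t] by (simp add: \<gamma>_def L_def)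
    show "\<phi> (s t) = snd (\<gamma> t) / fst (\<gamma> t)" "\<psi> (s t) = - 1 / fst (\<gamma> t)"
      using pos[OF s_mem[OF t]] by (simp_all add: \<gamma>_def L_def)
  qed (use bij s0 in auto)
  ultimately show ?thesis
    using \<xi>\<^sub>0 by (intro bexI[of _ \<xi>\<^sub>0]) auto
qed

text \<open>The trajectory exists for all times and \<open>x\<close> is integrable, so \<open>\<xi>\<close> has a finite limit, while
  \<open>\<phi> = x / \<lambda>\<close> decays like \<open>exp (- \<tau>)\<close>. That \<open>\<psi> \<rightarrow> - \<infinity>\<close> follows from the first integral
  \<open>(\<psi> + c \<phi>)\<^sup>2 / 2 + c \<xi> + ln \<phi>\<close>, whose last term tends to \<open>- \<infinity>\<close> while \<open>c \<xi>\<close> stays bounded.\<close>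

lemma quenching_solution_of_trajectory:
  assumes c: "c \<noteq> 0" and \<gamma>: "positive_trajectory_from c W \<gamma> J" and small: "\<bar>c * snd (\<gamma> 0)\<bar> < 1 / 2"
  shows "\<exists>m \<phi> \<psi>. quenching_solution c \<xi>\<^sub>0 m \<phi> \<psi> \<and> corresponds \<phi> \<psi> \<xi>\<^sub>0 m \<gamma> J"
proof -
  have J: "J = {0..}"
    using positive_trajectory_in_strip_is_global[OF \<gamma> small] .
  have sol: "solves_on (desing_field c) \<gamma> {0..}"
    and pos\<gamma>: "\<And>t. t \<in> {0..} \<Longrightarrow> fst (\<gamma> t) > 0" "\<And>t. t \<in> {0..} \<Longrightarrow> snd (\<gamma> t) > 0"
    using \<gamma> unfolding positive_trajectory_from_def forward_trajectory_def J by auto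
  define x where "x t = snd (\<gamma> t)" for t
  define l where "l t = fst (\<gamma> t)" for t
  have I: "is_interval {0 :: real..}" by (rule is_interval_ci)
  have pos: "l t > 0" "x t > 0" if "t \<in> {0..}" for t
    using pos\<gamma> that by (auto simp: l_def x_def)
  have dl: "(l has_real_derivative c * x t * l t - l t ^ 3) (at t within {0..})"
    and dx: "(x has_real_derivative - x t + x t * (c * x t - (l t)\<^sup>2)) (at t within {0..})" if "t \<in> {0..}" for t
    using sol that unfolding solves_on_desing_field_iff x_def l_def by auto
  have decay: "- x t + x t * (c * x t - (l t)\<^sup>2) \<le> - x t / 2" if "t \<in> {0..}" for t
    using positive_solution_strip_bounds(2)[of "{0..}" c \<gamma> t] I sol pos\<gamma>(2) small that
    unfolding x_def l_def by auto
  define w where "w t = c * x t / l t - 1 / l t" for t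
  \<comment> \<open>The first integral gives \<open>c \<xi> = \<tau> - w\<^sup>2 / 2 + const\<close> because \<open>\<tau> = - ln \<phi> + const\<close>. Since
    \<open>c \<noteq> 0\<close>, this is a closed form for the antiderivative of \<open>x\<close>.\<close>
  define s where "s t = \<xi>\<^sub>0 + (t - (w t)\<^sup>2 / 2 + (w 0)\<^sup>2 / 2) / c" for t
  have dw: "(w has_real_derivative - l t) (at t within {0..})" if "t \<in> {0..}" for t
    unfolding w_def using pos[OF that]
    by (auto intro!: derivative_eq_intros dl[OF that] dx[OF that]; simp add: divide_simps; simp add: algebra_simps power2_eq_square power3_eq_cube)
  have ds: "(s has_real_derivative x t) (at t within {0..})" if "t \<in> {0..}" for t
  proof -
    have "(s has_real_derivative (1 + w t * l t) / c) (at t within {0..})"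
      unfolding s_def using c by (auto intro!: derivative_eq_intros dw[OF that])
    moreover have "(1 + w t * l t) / c = x t"
      using c pos[OF that] by (simp add: w_def field_simps)
    ultimately show ?thesis by simp
  qed
  have s0: "s 0 = \<xi>\<^sub>0" by (simp add: s_def)
  have sm: "strict_mono_on {0..} s"
    using I ds pos(2) by (rule strict_mono_on_interval_if_deriv_pos)
  \<comment> \<open>As \<open>s' = x\<close> and \<open>x' \<le> - x / 2\<close>, this combination decreases, so \<open>s\<close> stays bounded and the
    wave quenches at a finite \<open>\<xi>\<close>.\<close>
  have "antimono_on {0..} (\<lambda>t. s t + 2 * x t)"
  proof (rule antimono_on_interval_if_deriv_nonpos[OF I])
    fix t :: real assume t: "t \<in> {0..}"
    show "((\<lambda>t. s t + 2 * x t) has_real_derivative x t + 2 * (- x t + x t * (c * x t - (l t)\<^sup>2))) (at t within {0..})"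
      by (auto intro!: derivative_eq_intros ds[OF t] dx[OF t])
    show "x t + 2 * (- x t + x t * (c * x t - (l t)\<^sup>2)) \<le> 0"
    proof -
      have "v + 2 * u \<le> 0" if "u \<le> - v / 2" for u v :: real
        using that by simp
      from this[OF decay[OF t]] show ?thesis .
    qed
  qed
  then have "s t + 2 * x t \<le> s 0 + 2 * x 0" if "t \<in> {0..}" for t
    using monotone_onD[of "{0..}" "(\<le>)" "(\<ge>)" "\<lambda>t. s t + 2 * x t" 0 t] that by simp
  then have s_bound: "s t \<le> \<xi>\<^sub>0 + 2 * x 0" if "t \<in> {0..}" for t
    using that pos(2)[OF that] s0 by fastforce
  define m where "m = Sup (s ` {0..})"
  have bdd: "bdd_above (s ` {0..})"
    using s_bound by (auto intro!: bdd_aboveI[of _ "\<xi>\<^sub>0 + 2 * x 0"])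
  have s_less: "s t < m" if "t \<in> {0..}" for t
  proof -
    have "s t < s (t + 1)"
      using that by (intro strict_mono_onD[OF sm]) auto
    also have "\<dots> \<le> m"
      unfolding m_def using that by (intro cSup_upper bdd) auto
    finally show ?thesis .
  qed
  have img: "s ` {0..} = {\<xi>\<^sub>0..<m}"
  proof (intro subset_antisym subsetI)
    fix y assume "y \<in> s ` {0..}"
    then obtain t where "t \<in> {0..}" "y = s t" by blast
    then show "y \<in> {\<xi>\<^sub>0..<m}"
      using strict_mono_on_leD[OF sm, of 0 t] s0 s_less by auto
  next
    fix y assume y: "y \<in> {\<xi>\<^sub>0..<m}"
    then obtain t where t: "t \<in> {0..}" "y < s t"
      using less_cSup_iff[of "s ` {0..}" y] bdd unfolding m_def by auto
    moreover have "continuous_on {0..t} s"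
      by (intro continuous_on_subset[OF DERIV_continuous_on[OF ds]]) auto
    ultimately show "y \<in> s ` {0..}"
      using IVT'[of s 0 y t] s0 y by auto
  qed
  have less_m: "\<xi>\<^sub>0 < m" using s_less[of 0] s0 by simp
  have bij: "bij_betw s {0..} {\<xi>\<^sub>0..<m}"
    using strict_mono_on_imp_inj_on[OF sm] img by (simp add: bij_betw_def)
  define g where "g = the_inv_into {0..} s"
  have gs: "g (s t) = t" if "t \<in> {0..}" for t
    unfolding g_def using strict_mono_on_imp_inj_on[OF sm] that by (rule the_inv_into_f_f)
  have g_img: "g ` {\<xi>\<^sub>0..<m} = {0..}"
    unfolding img[symmetric] image_image using gs by simp
  have g_top: "filterlim g at_top (at_left m)"
    unfolding filterlim_at_top_ge[where c = 0]
  proof (intro allI impI)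
    fix M :: real assume M: "0 \<le> M"
    have "\<forall>\<^sub>F \<xi> in at_left m. \<xi> \<in> {s M<..<m}"
      using M by (intro eventually_at_left_real s_less) simp
    then show "\<forall>\<^sub>F \<xi> in at_left m. M \<le> g \<xi>"
    proof eventually_elim
      case (elim \<xi>)
      have "\<xi>\<^sub>0 \<le> s M"
        using strict_mono_on_leD[OF sm, of 0 M] s0 M by simp
      then have "\<xi> \<in> s ` {0..}"
        using elim img by auto
      then obtain t where t: "t \<in> {0..}" "\<xi> = s t" by blast
      then have "M < t"
        using elim strict_mono_on_less[OF sm, of M t] M by simp
      then show ?case using gs t by simp
    qed
  qed
  define \<phi> where "\<phi> \<xi> = x (g \<xi>) / l (g \<xi>)" for \<xi>
  define \<psi> where "\<psi> \<xi> = - 1 / l (g \<xi>)" for \<xi>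
  have prof: "profile_solution c {\<xi>\<^sub>0..<m} \<phi> \<psi>"
    unfolding profile_solution_def
  proof
    fix \<xi> assume \<xi>: "\<xi> \<in> {\<xi>\<^sub>0..<m}"
    then obtain t where t: "t \<in> {0..}" "\<xi> = s t"
      using img by blast
    note g = gs[OF t(1), folded t(2)] and p = pos[OF t(1)]
    have "(g has_real_derivative 1 / x t) (at (s t) within {\<xi>\<^sub>0..<m})"
      using increasing_inverse_has_derivative[OF I ds pos(2) t(1)] unfolding img g_def .
    then have dg: "(g has_real_derivative 1 / x t) (at \<xi> within {\<xi>\<^sub>0..<m})"
      unfolding t(2) .
    have chain: "((\<lambda>\<xi>. f (g \<xi>)) has_real_derivative D * (1 / x t)) (at \<xi> within {\<xi>\<^sub>0..<m})"
      if "(f has_real_derivative D) (at t within {0..})" for f D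
      using DERIV_image_chain[of f D g \<xi> "{\<xi>\<^sub>0..<m}" "1 / x t"] that dg by (simp add: g_img g o_def)
    have "((\<lambda>t. x t / l t) has_real_derivative - x t / l t) (at t within {0..})"
      using p by (auto intro!: derivative_eq_intros dl[OF t(1)] dx[OF t(1)]; simp add: divide_simps; simp add: algebra_simps power2_eq_square power3_eq_cube)
    from chain[OF this] have d1: "(\<phi> has_real_derivative \<psi> \<xi>) (at \<xi> within {\<xi>\<^sub>0..<m})"
      unfolding \<phi>_def \<psi>_def using p by (simp add: g)
    have "((\<lambda>t. - 1 / l t) has_real_derivative c * x t / l t - l t) (at t within {0..})"
      using p by (auto intro!: derivative_eq_intros dl[OF t(1)]; simp add: divide_simps; simp add: algebra_simps power2_eq_square power3_eq_cube)
    from chain[OF this]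
    have "(\<psi> has_real_derivative (c * x t / l t - l t) * (1 / x t)) (at \<xi> within {\<xi>\<^sub>0..<m})"
      unfolding \<psi>_def .
    moreover have "(c * x t / l t - l t) * (1 / x t) = - c * \<psi> \<xi> - inverse (\<phi> \<xi>)"
      unfolding \<phi>_def \<psi>_def using p by (simp add: g field_simps)
    ultimately have "(\<psi> has_real_derivative - c * \<psi> \<xi> - inverse (\<phi> \<xi>)) (at \<xi> within {\<xi>\<^sub>0..<m})"
      by simp
    with d1 show "\<phi> \<xi> > 0 \<and> (\<phi> has_real_derivative \<psi> \<xi>) (at \<xi> within {\<xi>\<^sub>0..<m}) \<and>
        (\<psi> has_real_derivative - c * \<psi> \<xi> - inverse (\<phi> \<xi>)) (at \<xi> within {\<xi>\<^sub>0..<m})"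
      using p by (simp add: \<phi>_def g)
  qed
  \<comment> \<open>In the time \<open>\<tau>\<close> the equation for \<open>\<phi> = x / \<lambda>\<close> is linear: \<open>d\<phi>/d\<tau> = - \<phi>\<close>.\<close>
  have "\<exists>k. \<forall>t\<in>{0..}. x t / l t * exp t = k"
  proof (rule has_field_derivative_zero_constant)
    fix t :: real assume t: "t \<in> {0..}"
    show "((\<lambda>t. x t / l t * exp t) has_real_derivative 0) (at t within {0..})"
      using pos[OF t] by (auto intro!: derivative_eq_intros dl[OF t] dx[OF t]; simp add: divide_simps; simp add: algebra_simps power2_eq_square power3_eq_cube)
  qed simp
  then obtain k where k: "x t / l t * exp t = k" if "t \<in> {0..}" for t by blast
  have ratio: "x t / l t = k * exp (- t)" if "t \<in> {0..}" for t
    using k[OF that] by (simp add: exp_minus field_simps)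
  have "((\<lambda>t. k * exp (- t)) \<longlongrightarrow> 0) at_top"
    using tendsto_mult_right[OF filterlim_compose[OF exp_at_bot filterlim_uminus_at_bot_at_top], of k] by (simp add: mult.commute)
  moreover have "\<forall>\<^sub>F t in at_top. k * exp (- t) = x t / l t"
    using eventually_ge_at_top[of 0] by eventually_elim (simp add: ratio)
  ultimately have \<phi>_lim: "((\<lambda>t. x t / l t) \<longlongrightarrow> 0) at_top"
    by (rule Lim_transform_eventually)
  have \<psi>_lim: "filterlim (\<lambda>t. - 1 / l t) at_bot at_top"
    unfolding filterlim_at_bot_le[where c = 0]
  proof (intro allI impI)
    \<comment> \<open>The formula defining \<open>s\<close> and the boundedness of \<open>s\<close> force \<open>w\<^sup>2 \<rightarrow> \<infinity>\<close>. Once \<open>\<bar>c \<phi>\<bar> < 1\<close>, the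
      sign of \<open>\<psi> = w - c \<phi> < 0\<close> rules out large positive \<open>w\<close>.\<close>
    fix Z :: real assume Z: "Z \<le> 0"
    have "((\<lambda>t. \<bar>c * (x t / l t)\<bar>) \<longlongrightarrow> \<bar>c * 0\<bar>) at_top"
      by (intro tendsto_intros \<phi>_lim)
    then have "\<forall>\<^sub>F t in at_top. \<bar>c * (x t / l t)\<bar> < 1"
      by (rule order_tendstoD(2)) simp
    then show "\<forall>\<^sub>F t in at_top. - 1 / l t \<le> Z"
      using eventually_ge_at_top[of "max 0 ((1 - Z)\<^sup>2 / 2 + \<bar>c\<bar> * (2 * x 0))"]
    proof eventually_elim
      case (elim t)
      then have t: "t \<in> {0..}" by simp
      have "c * (s t - \<xi>\<^sub>0) = t - (w t)\<^sup>2 / 2 + (w 0)\<^sup>2 / 2"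
        using c by (simp add: s_def)
      moreover have "c * (s t - \<xi>\<^sub>0) \<le> \<bar>c\<bar> * (2 * x 0)"
      proof -
        have "0 \<le> s t - \<xi>\<^sub>0" "s t - \<xi>\<^sub>0 \<le> 2 * x 0"
          using strict_mono_on_leD[OF sm, of 0 t] s0 t s_bound[OF t] by auto
        then show ?thesis
          by (intro mult_mono) auto
      qed
      moreover have "(1 - Z)\<^sup>2 / 2 + \<bar>c\<bar> * (2 * x 0) \<le> t"
        using elim by simp
      ultimately have "(1 - Z)\<^sup>2 \<le> (w t)\<^sup>2"
        using zero_le_power2[of "w 0"] by linarith
      then have "1 - Z \<le> \<bar>w t\<bar>"
        using abs_le_square_iff[of "1 - Z" "w t"] by simp
      moreover have "- 1 / l t < 0" "w t = c * (x t / l t) + (- 1 / l t)"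
        using pos[OF t] by (auto simp: w_def)
      ultimately show ?case
        using elim(1) Z by linarith
    qed
  qed
  have "quenching_solution c \<xi>\<^sub>0 m \<phi> \<psi>"
    unfolding quenching_solution_def
    using less_m prof filterlim_compose[OF \<phi>_lim g_top] filterlim_compose[OF \<psi>_lim g_top]
    by (simp add: \<phi>_def[abs_def] \<psi>_def[abs_def])
  moreover have "corresponds \<phi> \<psi> \<xi>\<^sub>0 m \<gamma> J"
    unfolding corresponds_def J
  proof (intro exI[of _ s] conjI ballI)
    fix t :: real assume t: "t \<in> {0..}"
    show "(s has_real_derivative snd (\<gamma> t)) (at t within {0..})"
      using ds[OF t] by (simp add: x_def)
    show "\<phi> (s t) = snd (\<gamma> t) / fst (\<gamma> t)" "\<psi> (s t) = - 1 / fst (\<gamma> t)"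
      by (simp_all add: \<phi>_def \<psi>_def gs[OF t] x_def l_def)
  qed (use bij s0 in auto)
  ultimately show ?thesis by blast
qed

section \<open>Quenching rates\<close>

text \<open>The profile equation says \<open>(\<psi> + c \<phi>)' = - 1 / \<phi>\<close>; multiplying by \<open>\<psi> + c \<phi> = \<phi>' + c \<phi>\<close> makes the
  right-hand side the derivative of \<open>- ln \<phi> - c \<xi>\<close>.\<close>

lemma profile_first_integral:
  assumes prof: "profile_solution c I \<phi> \<psi>" and I: "convex I"
  shows "\<exists>K. \<forall>\<xi>\<in>I. (\<psi> \<xi> + c * \<phi> \<xi>)\<^sup>2 / 2 + c * \<xi> + ln (\<phi> \<xi>) = K"
proof (rule has_field_derivative_zero_constant[OF I])
  fix \<xi> assume "\<xi> \<in> I"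
  then have "\<phi> \<xi> > 0"
    and d: "(\<phi> has_real_derivative \<psi> \<xi>) (at \<xi> within I)"
      "(\<psi> has_real_derivative - c * \<psi> \<xi> - inverse (\<phi> \<xi>)) (at \<xi> within I)"
    using prof unfolding profile_solution_def by auto
  then show "((\<lambda>\<xi>. (\<psi> \<xi> + c * \<phi> \<xi>)\<^sup>2 / 2 + c * \<xi> + ln (\<phi> \<xi>)) has_real_derivative 0) (at \<xi> within I)"
    by (auto intro!: derivative_eq_intros d simp: field_simps power2_eq_square)
qed

text \<open>Near \<open>m\<close> one has \<open>dx/d\<xi> \<rightarrow> - 1\<close>, so \<open>x \<sim> m - \<xi>\<close> and \<open>\<phi> = - \<psi> x \<sim> - \<psi> (m - \<xi>)\<close>. In the first
  integral this turns \<open>- ln \<phi>\<close> into \<open>ln (1 / (m - \<xi>))\<close> up to \<open>ln (- \<psi>)\<close>, which is negligible against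
  \<open>\<psi>\<^sup>2\<close>, and therefore \<open>\<psi>\<^sup>2 \<sim> 2 ln (1 / (m - \<xi>))\<close>.\<close>

lemma quenching_rates_limits:
  assumes q: "quenching_solution c a m \<phi> \<psi>"
  shows "((\<lambda>\<xi>. \<phi> \<xi> / ((m - \<xi>) * sqrt (ln (inverse (m - \<xi>))))) \<longlongrightarrow> sqrt 2) (at_left m)"
    and "((\<lambda>\<xi>. \<psi> \<xi> / sqrt (ln (inverse (m - \<xi>)))) \<longlongrightarrow> - sqrt 2) (at_left m)"
proof -
  have am: "a < m" and prof: "profile_solution c {a..<m} \<phi> \<psi>"
    and \<phi>0: "(\<phi> \<longlongrightarrow> 0) (at_left m)" and \<psi>: "filterlim \<psi> at_bot (at_left m)"
    using q unfolding quenching_solution_def by auto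
  define x where "x \<xi> = - \<phi> \<xi> / \<psi> \<xi>" for \<xi>
  define L where "L \<xi> = ln (inverse (m - \<xi>))" for \<xi>
  have l0: "((\<lambda>\<xi>. - 1 / \<psi> \<xi>) \<longlongrightarrow> 0) (at_left m)" and x0: "(x \<longlongrightarrow> 0) (at_left m)"
    unfolding x_def by (rule quenching_solution_phase_limit[OF \<phi>0 \<psi>])+
  have "\<forall>\<^sub>F \<xi> in at_left m. \<psi> \<xi> < 0"
    using \<psi> by (auto simp: filterlim_at_bot_dense)
  then have ev: "\<forall>\<^sub>F \<xi> in at_left m. a < \<xi> \<and> \<xi> < m \<and> \<psi> \<xi> < 0 \<and> \<phi> \<xi> > 0"
    using eventually_at_left_real[OF am]
    by eventually_elim (use prof in \<open>auto simp: profile_solution_def\<close>)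
  \<comment> \<open>\<open>dx/d\<xi> = - 1 + c x - \<lambda>\<^sup>2 \<rightarrow> - 1\<close>\<close>
  have x_asymp: "((\<lambda>\<xi>. x \<xi> / (m - \<xi>)) \<longlongrightarrow> 1) (at_left m)"
  proof (rule lhopital_left[OF x0])
    show "((\<lambda>\<xi>. m - \<xi>) \<longlongrightarrow> 0) (at_left m)"
      by (auto intro!: tendsto_eq_intros)
    show "\<forall>\<^sub>F \<xi> in at_left m. m - \<xi> \<noteq> 0"
      using ev by eventually_elim auto
    show "\<forall>\<^sub>F \<xi> in at_left m. DERIV x \<xi> :> - 1 + c * x \<xi> - (- 1 / \<psi> \<xi>)\<^sup>2"
      using ev
    proof eventually_elim
      case (elim \<xi>)
      then have "(x has_real_derivative - 1 + c * x \<xi> - (- 1 / \<psi> \<xi>)\<^sup>2) (at \<xi> within {a..<m})"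
        unfolding x_def by (intro profile_time_field(2)[OF prof]) auto
      moreover have "at \<xi> within {a..<m} = at \<xi>"
        using elim by (intro at_within_interior) auto
      ultimately show ?case by metis
    qed
    show "\<forall>\<^sub>F \<xi> in at_left m. DERIV (\<lambda>\<xi>. m - \<xi>) \<xi> :> - 1"
      by (auto intro!: always_eventually derivative_eq_intros)
    show "((\<lambda>\<xi>. (- 1 + c * x \<xi> - (- 1 / \<psi> \<xi>)\<^sup>2) / - 1) \<longlongrightarrow> 1) (at_left m)"
      by (rule tendsto_eq_intros x0 l0 refl | simp)+
  qed simp
  have "filterlim (\<lambda>\<xi>. m - \<xi>) (at_right 0) (at_left m)"
  proof (rule tendsto_imp_filterlim_at_right)
    show "((\<lambda>\<xi>. m - \<xi>) \<longlongrightarrow> 0) (at_left m)"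
      by (auto intro!: tendsto_eq_intros)
    show "\<forall>\<^sub>F \<xi> in at_left m. 0 < m - \<xi>"
      using ev by eventually_elim auto
  qed
  then have L_top: "filterlim L at_top (at_left m)"
    unfolding L_def
    by (intro filterlim_compose[OF ln_at_top] filterlim_compose[OF filterlim_inverse_at_top_right])
  obtain K where K: "\<And>\<xi>. \<xi> \<in> {a..<m} \<Longrightarrow> (\<psi> \<xi> + c * \<phi> \<xi>)\<^sup>2 / 2 + c * \<xi> + ln (\<phi> \<xi>) = K"
    using profile_first_integral[OF prof] by auto
  \<comment> \<open>The first integral divided by \<open>\<psi>\<^sup>2\<close>, with \<open>\<phi> = - \<psi> x\<close> substituted in the logarithm.\<close>
  have "\<forall>\<^sub>F \<xi> in at_left m.
      (1 - c * x \<xi>)\<^sup>2 / 2 - (K - c * \<xi> - ln (x \<xi> / (m - \<xi>))) * (- 1 / \<psi> \<xi>)\<^sup>2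
        + ln (- \<psi> \<xi>) / (- \<psi> \<xi>) * (- 1 / \<psi> \<xi>) = L \<xi> / (\<psi> \<xi>)\<^sup>2"
    using ev
  proof eventually_elim
    case (elim \<xi>)
    have "\<phi> \<xi> = - \<psi> \<xi> * (x \<xi> / (m - \<xi>)) / inverse (m - \<xi>)"
      using elim by (simp add: x_def)
    moreover have "x \<xi> / (m - \<xi>) > 0"
      using elim unfolding x_def by (intro divide_pos_pos divide_neg_neg) auto
    moreover have "ln (A * y / R) = ln A + ln y - ln R" if "A > 0" "y > 0" "R > 0" for A y R :: real
      using that by (simp add: ln_div ln_mult)
    ultimately have "ln (\<phi> \<xi>) = ln (- \<psi> \<xi>) + ln (x \<xi> / (m - \<xi>)) - L \<xi>"
      using elim unfolding L_def by (metis diff_gt_0_iff_gt neg_0_less_iff_less positive_imp_inverse_positive)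
    moreover have "(\<psi> \<xi> + c * \<phi> \<xi>)\<^sup>2 = (1 - c * x \<xi>)\<^sup>2 * (\<psi> \<xi>)\<^sup>2"
      using elim by (simp add: x_def power_mult_distrib[symmetric] field_simps)
    ultimately have "(1 - c * x \<xi>)\<^sup>2 * (\<psi> \<xi>)\<^sup>2 / 2 + c * \<xi> + (ln (- \<psi> \<xi>) + ln (x \<xi> / (m - \<xi>)) - L \<xi>) = K"
      using K[of \<xi>] elim by simp
    then have "L \<xi> = (1 - c * x \<xi>)\<^sup>2 * (\<psi> \<xi>)\<^sup>2 / 2 - (K - c * \<xi> - ln (x \<xi> / (m - \<xi>))) + ln (- \<psi> \<xi>)"
      by linarith
    then show ?case
      using elim by (simp add: add_divide_distrib diff_divide_distrib power2_eq_square)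
  qed
  moreover have "((\<lambda>\<xi>. (1 - c * x \<xi>)\<^sup>2 / 2 - (K - c * \<xi> - ln (x \<xi> / (m - \<xi>))) * (- 1 / \<psi> \<xi>)\<^sup>2
        + ln (- \<psi> \<xi>) / (- \<psi> \<xi>) * (- 1 / \<psi> \<xi>)) \<longlongrightarrow>
      (1 - c * 0)\<^sup>2 / 2 - (K - c * m - ln 1) * 0\<^sup>2 + 0 * 0) (at_left m)"
  proof -
    have "filterlim (\<lambda>\<xi>. - \<psi> \<xi>) at_top (at_left m)"
      using \<psi> by (simp add: filterlim_uminus_at_bot)
    then have "((\<lambda>\<xi>. ln (- \<psi> \<xi>) / (- \<psi> \<xi>)) \<longlongrightarrow> 0) (at_left m)"
      by (rule filterlim_compose[OF ln_x_over_x_tendsto_0])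
    then show ?thesis
      by (intro tendsto_intros x0 l0 x_asymp) auto
  qed
  ultimately have "((\<lambda>\<xi>. L \<xi> / (\<psi> \<xi>)\<^sup>2) \<longlongrightarrow> 1 / 2) (at_left m)"
    using Lim_transform_eventually by fastforce
  from tendsto_real_sqrt[OF tendsto_inverse[OF this]]
  have "((\<lambda>\<xi>. sqrt (inverse (L \<xi> / (\<psi> \<xi>)\<^sup>2))) \<longlongrightarrow> sqrt 2) (at_left m)"
    by simp
  moreover have "\<forall>\<^sub>F \<xi> in at_left m. sqrt (inverse (L \<xi> / (\<psi> \<xi>)\<^sup>2)) = - (\<psi> \<xi> / sqrt (L \<xi>))"
    using ev by eventually_elim (simp add: real_sqrt_divide)
  ultimately have neg: "((\<lambda>\<xi>. - (\<psi> \<xi> / sqrt (L \<xi>))) \<longlongrightarrow> sqrt 2) (at_left m)"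
    by (rule Lim_transform_eventually)
  from tendsto_minus[OF this]
  show "((\<lambda>\<xi>. \<psi> \<xi> / sqrt (ln (inverse (m - \<xi>)))) \<longlongrightarrow> - sqrt 2) (at_left m)"
    by (simp add: L_def)
  have "\<forall>\<^sub>F \<xi> in at_left m. x \<xi> / (m - \<xi>) * - (\<psi> \<xi> / sqrt (L \<xi>)) = \<phi> \<xi> / ((m - \<xi>) * sqrt (L \<xi>))"
    using ev by eventually_elim (simp add: x_def)
  with tendsto_mult[OF x_asymp neg]
  show "((\<lambda>\<xi>. \<phi> \<xi> / ((m - \<xi>) * sqrt (ln (inverse (m - \<xi>))))) \<longlongrightarrow> sqrt 2) (at_left m)"
    using Lim_transform_eventually unfolding L_def by fastforce
qed

theorem theorem4p23:
  fixes c :: real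
  assumes "c \<noteq> 0"
  shows
    "(\<exists>N. open N \<and> (0, 0) \<in> N \<and>
        (\<exists>W. local_center_stable_manifold (desing_field c) (0, 0) W \<and> W \<subseteq> N) \<and>
        (\<forall>W. local_center_stable_manifold (desing_field c) (0, 0) W \<and> W \<subseteq> N \<longrightarrow>
           (\<forall>a \<xi>\<^sub>m\<^sub>a\<^sub>x \<phi> \<psi>. quenching_solution c a \<xi>\<^sub>m\<^sub>a\<^sub>x \<phi> \<psi> \<longrightarrow>
              (\<exists>\<xi>\<^sub>0\<in>{a..<\<xi>\<^sub>m\<^sub>a\<^sub>x}. \<exists>\<gamma> J. positive_trajectory_from c W \<gamma> J \<and>
                 corresponds \<phi> \<psi> \<xi>\<^sub>0 \<xi>\<^sub>m\<^sub>a\<^sub>x \<gamma> J)) \<and>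
           (\<forall>\<gamma> J \<xi>\<^sub>0. positive_trajectory_from c W \<gamma> J \<longrightarrow>
              (\<exists>\<xi>\<^sub>m\<^sub>a\<^sub>x \<phi> \<psi>. quenching_solution c \<xi>\<^sub>0 \<xi>\<^sub>m\<^sub>a\<^sub>x \<phi> \<psi> \<and>
                 corresponds \<phi> \<psi> \<xi>\<^sub>0 \<xi>\<^sub>m\<^sub>a\<^sub>x \<gamma> J)))) \<and>
     (\<forall>a \<xi>\<^sub>m\<^sub>a\<^sub>x \<phi> \<psi>. quenching_solution c a \<xi>\<^sub>m\<^sub>a\<^sub>x \<phi> \<psi> \<longrightarrow>
        (\<exists>C>0. \<phi> \<sim>[at_left \<xi>\<^sub>m\<^sub>a\<^sub>x]
           (\<lambda>\<xi>. C * (\<xi>\<^sub>m\<^sub>a\<^sub>x - \<xi>) * sqrt (ln (inverse (\<xi>\<^sub>m\<^sub>a\<^sub>x - \<xi>))))) \<and>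
        (\<exists>C>0. \<psi> \<sim>[at_left \<xi>\<^sub>m\<^sub>a\<^sub>x]
           (\<lambda>\<xi>. - C * sqrt (ln (inverse (\<xi>\<^sub>m\<^sub>a\<^sub>x - \<xi>))))))"
proof (rule conjI)
  \<comment> \<open>The strip in which \<open>x\<close> decays exponentially.\<close>
  define N where "N = {p :: real \<times> real. \<bar>c * snd p\<bar> < 1 / 2}"
  have N: "open N" "(0, 0) \<in> N"
    unfolding N_def by (auto intro!: open_Collect_less continuous_intros)
  have to_trajectory: "\<exists>\<xi>\<^sub>0\<in>{a..<m}. \<exists>\<gamma> J. positive_trajectory_from c W \<gamma> J \<and> corresponds \<phi> \<psi> \<xi>\<^sub>0 m \<gamma> J"
    if "local_center_stable_manifold (desing_field c) (0, 0) W" "quenching_solution c a m \<phi> \<psi>" for W a m \<phi> \<psi>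
    using that trajectory_of_quenching_solution[of c a m \<phi> \<psi> W]
    by (simp add: center_stable_manifold_iff_open_neighbourhood)
  have to_quenching: "\<exists>m \<phi> \<psi>. quenching_solution c \<xi>\<^sub>0 m \<phi> \<psi> \<and> corresponds \<phi> \<psi> \<xi>\<^sub>0 m \<gamma> J"
    if "W \<subseteq> N" "positive_trajectory_from c W \<gamma> J" for W \<gamma> J \<xi>\<^sub>0
  proof (rule quenching_solution_of_trajectory[OF assms that(2)])
    show "\<bar>c * snd (\<gamma> 0)\<bar> < 1 / 2"
      using that unfolding positive_trajectory_from_def N_def by auto
  qed
  have "local_center_stable_manifold (desing_field c) (0, 0) N"
    using N by (simp add: center_stable_manifold_iff_open_neighbourhood)
  with N to_trajectory to_quenching
  show "\<exists>N. open N \<and> (0, 0) \<in> N \<and>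
        (\<exists>W. local_center_stable_manifold (desing_field c) (0, 0) W \<and> W \<subseteq> N) \<and>
        (\<forall>W. local_center_stable_manifold (desing_field c) (0, 0) W \<and> W \<subseteq> N \<longrightarrow>
           (\<forall>a \<xi>\<^sub>m\<^sub>a\<^sub>x \<phi> \<psi>. quenching_solution c a \<xi>\<^sub>m\<^sub>a\<^sub>x \<phi> \<psi> \<longrightarrow>
              (\<exists>\<xi>\<^sub>0\<in>{a..<\<xi>\<^sub>m\<^sub>a\<^sub>x}. \<exists>\<gamma> J. positive_trajectory_from c W \<gamma> J \<and>
                 corresponds \<phi> \<psi> \<xi>\<^sub>0 \<xi>\<^sub>m\<^sub>a\<^sub>x \<gamma> J)) \<and>
           (\<forall>\<gamma> J \<xi>\<^sub>0. positive_trajectory_from c W \<gamma> J \<longrightarrow>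
              (\<exists>\<xi>\<^sub>m\<^sub>a\<^sub>x \<phi> \<psi>. quenching_solution c \<xi>\<^sub>0 \<xi>\<^sub>m\<^sub>a\<^sub>x \<phi> \<psi> \<and>
                 corresponds \<phi> \<psi> \<xi>\<^sub>0 \<xi>\<^sub>m\<^sub>a\<^sub>x \<gamma> J)))"
    by (intro exI[of _ N] conjI allI impI exI[of _ N]) auto
next
  show "\<forall>a \<xi>\<^sub>m\<^sub>a\<^sub>x \<phi> \<psi>. quenching_solution c a \<xi>\<^sub>m\<^sub>a\<^sub>x \<phi> \<psi> \<longrightarrow>
        (\<exists>C>0. \<phi> \<sim>[at_left \<xi>\<^sub>m\<^sub>a\<^sub>x]
           (\<lambda>\<xi>. C * (\<xi>\<^sub>m\<^sub>a\<^sub>x - \<xi>) * sqrt (ln (inverse (\<xi>\<^sub>m\<^sub>a\<^sub>x - \<xi>))))) \<and>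
        (\<exists>C>0. \<psi> \<sim>[at_left \<xi>\<^sub>m\<^sub>a\<^sub>x]
           (\<lambda>\<xi>. - C * sqrt (ln (inverse (\<xi>\<^sub>m\<^sub>a\<^sub>x - \<xi>)))))"
  proof (intro allI impI conjI)
    fix a m \<phi> \<psi> assume "quenching_solution c a m \<phi> \<psi>"
    note lims = quenching_rates_limits[OF this]
    have "\<phi> \<sim>[at_left m] (\<lambda>\<xi>. sqrt 2 * (m - \<xi>) * sqrt (ln (inverse (m - \<xi>))))"
      using asymp_equivI'_const[OF lims(1)] by (simp add: mult.assoc)
    then show "\<exists>C>0. \<phi> \<sim>[at_left m] (\<lambda>\<xi>. C * (m - \<xi>) * sqrt (ln (inverse (m - \<xi>))))"
      by (intro exI[of _ "sqrt 2"]) simp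
    have "\<psi> \<sim>[at_left m] (\<lambda>\<xi>. - sqrt 2 * sqrt (ln (inverse (m - \<xi>))))"
      by (rule asymp_equivI'_const[OF lims(2)]) simp
    then show "\<exists>C>0. \<psi> \<sim>[at_left m] (\<lambda>\<xi>. - C * sqrt (ln (inverse (m - \<xi>))))"
      by (intro exI[of _ "sqrt 2"]) simp
  qed
qed

end
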